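(* Let $g\ge 0$ be an integer, fix the length $n$ of $x$, and let $\lambda$ be an unordered partition of $2g-2+n$. Then in each chamber $\mathfrak c$ of the resonance arrangement each of the two functions $$x\mapsto h^{\le,\circ}_{g;x,\lambda},\qquad x\mapsto h^{<,\circ}_{g;x,\lambda}$$ is a polynomial of degree at most $4g-3+n$; that is, for each of the two functions there is a polynomial $P$ in the variables $x_1,\dots,x_n$ of degree at most $4g-3+n$ whose value at $x$ equals the value of the function for every $x\in\mathfrak c\cap(\mathbb Z\setminus\{0\})^n$.
   Context: Throughout, $x=(x_1,\dots,x_n)\in(\mathbb Z\setminus\{0\})^n$ with $\sum_i x_i=0$; $x^+$ (resp. $x^-$) is the tuple of positive entries of $x$ (resp. of $-x$). **Power series.** $\zeta(z)=e^{z/2}-e^{-z/2}$ and $\mathcal S(z)=\zeta(z)/z$. $[z^k]F(z)$ denotes the coefficient of $z^k$ in a (Laurent) series $F$. **Covers.** Let $\lambda=(\lambda_1,\dots,\lambda_\ell)$ be an ordered partition (a sequence of positive integers) of $2g-2+n$, and fix points $p_1<\dots<p_\ell$ of $\mathbb R$. A connected tropical cover $\pi:\Gamma\to\mathbb R$ of type $(g,x,\lambda)$ consists of a connected graph $\Gamma$ with bounded edges and unbounded edges (ends), mapped to $\mathbb R$ so that each edge $e$ is mapped linearly with a positive integer slope $\omega(e)$, called its weight, and such that - the left-pointing ends of $\Gamma$ have weights given by $x^+$ and the right-pointing ends have weights given by $x^-$; the ends are labelled by the entries $x_1,\dots,x_n$; - $\Gamma$ has $\ell$ (inner) vertices $v_1,\dots,v_\ell$,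 with $\pi(v_i)=p_i$; multiple edges between the same two vertices are allowed; - each vertex $v_i$ carries a non-negative integer genus $g(v_i)$, with $\lambda_i=\mathrm{val}(v_i)+2g(v_i)-2$, where the valency $\mathrm{val}$ counts all adjacent edges including ends; - balancing: at each vertex the sum of the weights of the adjacent edges arriving from the left equals the sum of the weights of the adjacent edges leaving to the right; - $b_1(\Gamma)+\sum_i g(v_i)=g$, where $b_1$ is the first Betti number. Covers are considered up to isomorphism preserving all this data (in particular the labelling of the ends and the images of the vertices), and $\mathrm{Aut}(\pi)$ is the group of automorphisms in this sense. **Vertex multiplicity.** For a vertex $v=v_i$ let $y_1,\dots,y_{\mathrm{val}(v)}$ be the weights of all its adjacent edges. Put $$m_{v}=(\lambda_i-1)!\sum_{g_1+g_2=g(v)}\Big([z^{2g_2-1}]\tfrac{1}{\zeta(z)}\Big)\Big([z^{2g_1}]\tfrac{\prod_{j}\mathcal S(y_jz)}{\mathcal S(z)}\Big),$$ with $g_1,g_2\ge 0$. (This equals $(\lambda_i-1)!\,|\mathrm{Aut}(y^+)||\mathrm{Aut}(y^-)|\sum_{g_1+g_2=g(v)}\langle\tau_{2g_2-2}(\omega)\rangle^{\mathbb P^1,\circ}_{g_2}\langle y^+,\tau_{2g_1-2+\mathrm{val}(v)}(\omega),y^-\rangle^{\mathbb P^1,\circ}_{g_1}$, where $y^\pm$ are the tuples of weights of the edges on the two sides of $v$, $\omega$ is the point class, and the brackets are connected (relative) Gromov–Witten invariants of $\mathbb P^1$.) **$\lambda$-invariants.** For an ordered partition $\lambda$ of $2g-2+n$,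 $$\vec h^{\le,\circ}_{g;x,\lambda}=\sum_{\pi}\frac{1}{|\mathrm{Aut}(\pi)|}\frac{1}{\ell(\lambda)!}\prod_{v}m_v\prod_{e}\omega(e),\qquad \vec h^{<,\circ}_{g;x,\lambda}=\sum_{\pi}\frac{1}{|\mathrm{Aut}(\pi)|}\frac{1}{\ell(\lambda)!}\prod_{v}(-1)^{1+\mathrm{val}(v)}m_v\prod_{e}\omega(e),$$ where the sums run over isomorphism classes of connected tropical covers $\pi:\Gamma\to\mathbb R$ of type $(g,x,\lambda)$, $v$ runs over the vertices and $e$ over the bounded edges of $\Gamma$, and $\ell(\lambda)$ is the number of parts of $\lambda$. For an unordered partition $\lambda$, $h^{\le,\circ}_{g;x,\lambda}$ (resp. $h^{<,\circ}_{g;x,\lambda}$) is the sum of $\vec h^{\le,\circ}_{g;x,\lambda'}$ (resp. $\vec h^{<,\circ}_{g;x,\lambda'}$) over all distinct ordered partitions $\lambda'$ obtained by ordering the parts of $\lambda$. **Resonance arrangement.** In the hyperplane $\{x\in\mathbb R^n:\sum_i x_i=0\}$ it is the arrangement of the hyperplanes $W_I=\{\sum_{i\in I}x_i=0\}$ for all non-empty proper subsets $I\subset\{1,\dots,n\}$. Its chambers are the connected components of the complement. *)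

theory Defs
  imports
    "HOL-Analysis.Analysis"
    "HOL-Computational_Algebra.Computational_Algebra"
    "HOL-Combinatorics.Combinatorics"
    "HOL-Library.Poly_Mapping"
    "Graph_Theory.Graph_Theory"
begin

section \<open>Power series\<close>

definition zeta_series :: "real fps" where
  "zeta_series = fps_exp (1/2) - fps_exp (- 1/2)"

definition S_series :: "real fps" where
  "S_series = zeta_series / fps_X"

text \<open>
  \<open>vertex_mult l k Y\<close> is the multiplicity of a vertex of genus \<open>k\<close> over a point with part \<open>l\<close>,
  where \<open>Y\<close> is the multiset of the weights of all adjacent edges. The series \<open>1 / zeta\<close> has a
  simple pole, so it is taken among Laurent series; its coefficient at \<open>g\<^sub>2 = 0\<close> is that of \<open>1/z\<close>.
\<close>
definition vertex_mult :: "nat \<Rightarrow> nat \<Rightarrow> nat multiset \<Rightarrow> real" where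
  "vertex_mult l k Y = fact (l - 1) *
     (\<Sum>(g1, g2) \<in> {(g1, g2). g1 + g2 = k}.
        fls_nth (1 / fps_to_fls zeta_series) (2 * int g2 - 1) *
        fps_nth ((\<Prod>y\<in>#Y. S_series oo (fps_const (real y) * fps_X)) / S_series) (2 * g1))"


section \<open>Tropical covers of the real line\<close>

text \<open>
  Since the vertices of a cover have prescribed, pairwise distinct images, the vertex over the
  point \<open>p i\<close> is identified with its index \<open>i\<close>; indices start at \<open>0\<close>. A bounded edge is an arc
  directed from its left to its right end point. The ends are identified with their labels, that
  is, with the elements of the index type \<open>'n\<close> of \<open>x :: int ^ 'n\<close>: the end \<open>i\<close> points to the left
  and has weight \<open>x $ i\<close> if \<open>x $ i > 0\<close>, and it points to the right and has weight \<open>- x $ i\<close> if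
  \<open>x $ i < 0\<close>. Every end is attached to an inner vertex. Bounded edges are named by natural
  numbers; the names are forgotten on passing to isomorphism classes.
\<close>
record 'n cover =
  skel :: "(nat, nat) pre_digraph"  \<comment> \<open>inner vertices and bounded edges\<close>
  wt :: "nat \<Rightarrow> nat"                 \<comment> \<open>weights (slopes) of the bounded edges\<close>
  len :: "nat \<Rightarrow> real"               \<comment> \<open>lengths of the bounded edges\<close>
  att :: "'n \<Rightarrow> nat"                 \<comment> \<open>vertices to which the ends are attached\<close>
  vgen :: "nat \<Rightarrow> nat"               \<comment> \<open>genera of the vertices\<close>

definition adjacent_weights :: "int ^ 'n::finite \<Rightarrow> 'n cover \<Rightarrow> nat \<Rightarrow> nat multiset" where
  "adjacent_weights x \<pi> v =
     image_mset (wt \<pi>) (mset_set (in_arcs (skel \<pi>) v \<union> out_arcs (skel \<pi>) v)) +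
     image_mset (\<lambda>i. nat \<bar>x $ i\<bar>) (mset_set {i. att \<pi> i = v})"

definition valency :: "int ^ 'n::finite \<Rightarrow> 'n cover \<Rightarrow> nat \<Rightarrow> nat" where
  "valency x \<pi> v = size (adjacent_weights x \<pi> v)"

text \<open>The first Betti number of a connected graph; ends do not contribute to it.\<close>
definition betti :: "(nat, nat) pre_digraph \<Rightarrow> int" where
  "betti G = int (card (arcs G)) - int (card (verts G)) + 1"

definition balanced :: "int ^ 'n::finite \<Rightarrow> 'n cover \<Rightarrow> nat \<Rightarrow> bool" where
  "balanced x \<pi> v \<longleftrightarrow>
     (\<Sum>e\<in>in_arcs (skel \<pi>) v. int (wt \<pi> e)) + (\<Sum>i | att \<pi> i = v \<and> x $ i > 0. x $ i) =
     (\<Sum>e\<in>out_arcs (skel \<pi>) v. int (wt \<pi> e)) + (\<Sum>i | att \<pi> i = v \<and> x $ i < 0. - x $ i)"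

text \<open>
  Connected tropical covers of type \<open>(g, x, ls)\<close>. The notion of connectedness for digraphs used
  here ignores the directions of the arcs and requires at least one vertex.
\<close>
definition covers ::
  "(nat \<Rightarrow> real) \<Rightarrow> nat \<Rightarrow> int ^ 'n::finite \<Rightarrow> nat list \<Rightarrow> 'n cover set" where
  "covers p g x ls = {\<pi>.
     fin_digraph (skel \<pi>) \<and>
     verts (skel \<pi>) = {..<length ls} \<and>
     Digraph_Component.connected (skel \<pi>) \<and>
     (\<forall>e\<in>arcs (skel \<pi>). wt \<pi> e > 0 \<and> len \<pi> e > 0 \<and>
        p (head (skel \<pi>) e) - p (tail (skel \<pi>) e) = real (wt \<pi> e) * len \<pi> e) \<and>
     (\<forall>i. att \<pi> i \<in> verts (skel \<pi>)) \<and>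
     (\<forall>v\<in>verts (skel \<pi>). int (ls ! v) = int (valency x \<pi> v) + 2 * int (vgen \<pi> v) - 2) \<and>
     (\<forall>v\<in>verts (skel \<pi>). balanced x \<pi> v) \<and>
     betti (skel \<pi>) + (\<Sum>v\<in>verts (skel \<pi>). int (vgen \<pi> v)) = int g}"

text \<open>
  An isomorphism is the identity on vertices and on ends, because it preserves the images of the
  vertices and the labels of the ends. It is therefore given by its effect on the bounded edges.
\<close>
definition cover_iso :: "(nat \<Rightarrow> nat) \<Rightarrow> 'n cover \<Rightarrow> 'n cover \<Rightarrow> bool" where
  "cover_iso f \<pi> \<pi>' \<longleftrightarrow>
     verts (skel \<pi>) = verts (skel \<pi>') \<and>
     bij_betw f (arcs (skel \<pi>)) (arcs (skel \<pi>')) \<and>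
     (\<forall>e\<in>arcs (skel \<pi>).
        tail (skel \<pi>') (f e) = tail (skel \<pi>) e \<and>
        head (skel \<pi>') (f e) = head (skel \<pi>) e \<and>
        wt \<pi>' (f e) = wt \<pi> e \<and>
        len \<pi>' (f e) = len \<pi> e) \<and>
     att \<pi>' = att \<pi> \<and>
     (\<forall>v\<in>verts (skel \<pi>). vgen \<pi>' v = vgen \<pi> v)"

definition cover_rel ::
  "(nat \<Rightarrow> real) \<Rightarrow> nat \<Rightarrow> int ^ 'n::finite \<Rightarrow> nat list \<Rightarrow> ('n cover \<times> 'n cover) set" where
  "cover_rel p g x ls =
     {(\<pi>, \<pi>'). \<pi> \<in> covers p g x ls \<and> \<pi>' \<in> covers p g x ls \<and> (\<exists>f. cover_iso f \<pi> \<pi>')}"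

lemma equiv_cover_rel: "equiv (covers p g x ls) (cover_rel p g x ls)"
proof (rule equivI)
  show "cover_rel p g x ls \<subseteq> covers p g x ls \<times> covers p g x ls"
    by (auto simp: cover_rel_def)
  show "refl_on (covers p g x ls) (cover_rel p g x ls)"
    by (auto simp: refl_on_def cover_rel_def cover_iso_def intro!: exI[of _ id])
  show "sym (cover_rel p g x ls)"
  proof (rule symI)
    fix a b assume "(a, b) \<in> cover_rel p g x ls"
    then obtain f where *: "a \<in> covers p g x ls" "b \<in> covers p g x ls" "cover_iso f a b"
      by (auto simp: cover_rel_def)
    define h where "h = inv_into (arcs (skel a)) f"
    have f: "bij_betw f (arcs (skel a)) (arcs (skel b))" using * by (simp add: cover_iso_def)
    then have "bij_betw h (arcs (skel b)) (arcs (skel a))" unfolding h_def by (rule bij_betw_inv_into)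
    moreover have "\<forall>e\<in>arcs (skel b). h e \<in> arcs (skel a) \<and> f (h e) = e"
      using f unfolding h_def by (metis bij_betw_inv_into_right bij_betw_apply bij_betw_inv_into)
    ultimately have "cover_iso h b a" using *(3) unfolding cover_iso_def by metis
    then show "(b, a) \<in> cover_rel p g x ls" using * by (auto simp: cover_rel_def)
  qed
  show "trans (cover_rel p g x ls)"
  proof (rule transI)
    fix a b c assume "(a, b) \<in> cover_rel p g x ls" "(b, c) \<in> cover_rel p g x ls"
    then obtain f h where *: "a \<in> covers p g x ls" "c \<in> covers p g x ls"
      "cover_iso f a b" "cover_iso h b c"
      by (auto simp: cover_rel_def)
    have "cover_iso (h \<circ> f) a c"
      using *(3,4) unfolding cover_iso_def
      by (auto intro: bij_betw_trans simp: bij_betw_apply)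
    then show "(a, c) \<in> cover_rel p g x ls" using * by (auto simp: cover_rel_def)
  qed
qed

definition Aut :: "'n cover \<Rightarrow> (nat \<Rightarrow> nat) set" where
  "Aut \<pi> = {f. f permutes arcs (skel \<pi>) \<and> cover_iso f \<pi> \<pi>}"


section \<open>The invariants\<close>

definition cover_mult_le :: "int ^ 'n::finite \<Rightarrow> nat list \<Rightarrow> 'n cover \<Rightarrow> real" where
  "cover_mult_le x ls \<pi> =
     1 / real (card (Aut \<pi>)) * (1 / fact (length ls)) *
     (\<Prod>v\<in>verts (skel \<pi>). vertex_mult (ls ! v) (vgen \<pi> v) (adjacent_weights x \<pi> v)) *
     (\<Prod>e\<in>arcs (skel \<pi>). real (wt \<pi> e))"

definition cover_mult_lt :: "int ^ 'n::finite \<Rightarrow> nat list \<Rightarrow> 'n cover \<Rightarrow> real" where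
  "cover_mult_lt x ls \<pi> =
     1 / real (card (Aut \<pi>)) * (1 / fact (length ls)) *
     (\<Prod>v\<in>verts (skel \<pi>). (- 1) ^ (1 + valency x \<pi> v) *
        vertex_mult (ls ! v) (vgen \<pi> v) (adjacent_weights x \<pi> v)) *
     (\<Prod>e\<in>arcs (skel \<pi>). real (wt \<pi> e))"

text \<open>The sums run over isomorphism classes; the summand is evaluated at a representative.\<close>

definition h_vec_le :: "(nat \<Rightarrow> real) \<Rightarrow> nat \<Rightarrow> int ^ 'n::finite \<Rightarrow> nat list \<Rightarrow> real" where
  "h_vec_le p g x ls =
     (\<Sum>K \<in> covers p g x ls // cover_rel p g x ls. cover_mult_le x ls (SOME \<pi>. \<pi> \<in> K))"

definition h_vec_lt :: "(nat \<Rightarrow> real) \<Rightarrow> nat \<Rightarrow> int ^ 'n::finite \<Rightarrow> nat list \<Rightarrow> real" where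
  "h_vec_lt p g x ls =
     (\<Sum>K \<in> covers p g x ls // cover_rel p g x ls. cover_mult_lt x ls (SOME \<pi>. \<pi> \<in> K))"

definition h_le :: "(nat \<Rightarrow> real) \<Rightarrow> nat \<Rightarrow> int ^ 'n::finite \<Rightarrow> nat multiset \<Rightarrow> real" where
  "h_le p g x lam = (\<Sum>ls \<in> permutations_of_multiset lam. h_vec_le p g x ls)"

definition h_lt :: "(nat \<Rightarrow> real) \<Rightarrow> nat \<Rightarrow> int ^ 'n::finite \<Rightarrow> nat multiset \<Rightarrow> real" where
  "h_lt p g x lam = (\<Sum>ls \<in> permutations_of_multiset lam. h_vec_lt p g x ls)"


section \<open>Resonance arrangement\<close>

definition resonance_complement :: "(real ^ 'n::finite) set" where
  "resonance_complement =
     {y. (\<Sum>i\<in>UNIV. y $ i) = 0} -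
     (\<Union>I \<in> {I. I \<noteq> {} \<and> I \<noteq> UNIV}. {y. (\<Sum>i\<in>I. y $ i) = 0})"

definition resonance_chambers :: "(real ^ 'n::finite) set set" where
  "resonance_chambers = components resonance_complement"


section \<open>Polynomials in the variables indexed by \<open>'n\<close>\<close>

text \<open>A monomial is the finitely supported function of its exponents.\<close>

definition poly_eval :: "(('n::finite \<Rightarrow>\<^sub>0 nat) \<Rightarrow>\<^sub>0 real) \<Rightarrow> real ^ 'n \<Rightarrow> real" where
  "poly_eval P y =
     (\<Sum>m \<in> Poly_Mapping.keys P.
        Poly_Mapping.lookup P m * (\<Prod>i\<in>UNIV. y $ i ^ Poly_Mapping.lookup m i))"

text \<open>The bound is an integer because it can be \<open>-1\<close>; then only the zero polynomial satisfies it.\<close>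
definition total_degree_le :: "(('n::finite \<Rightarrow>\<^sub>0 nat) \<Rightarrow>\<^sub>0 real) \<Rightarrow> int \<Rightarrow> bool" where
  "total_degree_le P d \<longleftrightarrow>
     (\<forall>m \<in> Poly_Mapping.keys P. int (\<Sum>i\<in>UNIV. Poly_Mapping.lookup m i) \<le> d)"

definition polynomial_on_chamber ::
  "(real ^ 'n::finite) set \<Rightarrow> (int ^ 'n \<Rightarrow> real) \<Rightarrow> int \<Rightarrow> bool" where
  "polynomial_on_chamber C F d \<longleftrightarrow>
     (\<exists>P. total_degree_le P d \<and>
        (\<forall>x. (\<forall>i. x $ i \<noteq> 0) \<longrightarrow> (\<chi> i. real_of_int (x $ i)) \<in> C \<longrightarrow>
           F x = poly_eval P (\<chi> i. real_of_int (x $ i))))"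

end

theory Submission
  imports Defs
begin

text \<open>
  Up to the choice of an enumeration of the bounded edges, a cover is a combinatorial type (a graph,
  the attachment of the ends, the genera) together with positive integer weights that form a flow:
  the excess of a vertex is the sum \<open>b(v)\<close> of the entries of \<open>x\<close> attached to it. There are finitely
  many types, independent of \<open>x\<close>, and the multiplicity is polynomial in the weights and the
  absolute values of the entries of \<open>x\<close>. So it has to be shown that, in one chamber, the sum of a
  monomial over all positive flows with excess \<open>b\<close> is a polynomial in \<open>b\<close>
  (\<open>flow_sum_cut_polynomial\<close>).

  The edges are summed out one at a time. For an edge from \<open>u\<close> to \<open>v\<close> of weight \<open>t\<close> the rest of
  the graph sees the excess \<open>b - t (u - v)\<close>. If the sum over the rest is polynomial wherever the signs
  of certain cut values \<open>b(S)\<close>, the sums of \<open>b\<close> over \<open>S\<close>, are fixed, then the sum over \<open>t\<close> has its breakpoints at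
  the values \<open>b(S)\<close> of the cuts with \<open>u\<close> inside and \<open>v\<close> outside, and the result depends on the order
  of these breakpoints. In general this order is not determined by signs of cut values. It is if
  the cuts are nested, because then the difference of \<open>b(S)\<close> and \<open>b(T)\<close> is, up to sign, the
  value of the symmetric difference. Therefore the sum is kept as a combination of terms, each
  belonging to its own cross-free family of cuts: in such a family the cuts that separate \<open>u\<close> from
  \<open>v\<close> form a chain. Summation by parts splits the sum over \<open>t\<close> into one term for each cut \<open>T\<close>
  of the chain, and the signs that occur in this term are those of a new family, the pivot at \<open>T\<close>, which is
  again cross-free (\<open>cut_family_pivot\<close>, \<open>cut_polynomial_edge_sum\<close>). The fundamental cuts of a spanning
  tree are the typical cross-free family, and pivoting is the exchange of a tree edge.

  Finally every cut value is the sum of a subset of the entries of \<open>x\<close>. Its sign is constant on a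
  chamber of the resonance arrangement, so all the terms become polynomials there.

  For the degree, an edge joining two components has its weight determined by
  \<open>b\<close>, and only the other edges, as many as the first Betti number, add one for the summation.
  With \<open>l\<close> vertices the total is \<open>2 * g + l - 1\<close>, and \<open>l\<close> is at most \<open>2 * g - 2 + n\<close> because the
  parts of the partition are positive.
\<close>

section \<open>Polynomial functions and their sums\<close>

text \<open>
  Polynomials in the coordinate functions \<open>L\<close>. They are generated by multiplication by one
  coordinate at a time, so that no induction meets a product of two unknown polynomials. Only the
  values on \<open>Y\<close> count; \<open>Y\<close> will be a chamber, or the vectors of sum \<open>0\<close>.
\<close>
inductive poly_on :: "'a set \<Rightarrow> ('a \<Rightarrow> real) set \<Rightarrow> nat \<Rightarrow> ('a \<Rightarrow> real) \<Rightarrow> bool"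
  for Y :: "'a set" and L :: "('a \<Rightarrow> real) set" where
  const: "poly_on Y L d (\<lambda>_. c)"
| add: "poly_on Y L d f \<Longrightarrow> poly_on Y L d h \<Longrightarrow> poly_on Y L d (\<lambda>y. f y + h y)"
| coord: "l \<in> L \<Longrightarrow> poly_on Y L d f \<Longrightarrow> poly_on Y L (Suc d) (\<lambda>y. l y * f y)"
| cong: "poly_on Y L d f \<Longrightarrow> (\<And>y. y \<in> Y \<Longrightarrow> f y = h y) \<Longrightarrow> poly_on Y L d h"

lemma poly_on_Suc: "poly_on Y L d f \<Longrightarrow> poly_on Y L (Suc d) f"
proof (induction rule: poly_on.induct)
  case (cong d f h)
  then show ?case by (auto intro: poly_on.cong)
qed (auto intro: poly_on.intros)

lemma poly_on_mono: "poly_on Y L d f \<Longrightarrow> d \<le> e \<Longrightarrow> poly_on Y L e f"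
  by (induction e) (auto simp: le_Suc_eq intro: poly_on_Suc)

lemma poly_on_coord: "l \<in> L \<Longrightarrow> poly_on Y L (Suc 0) l"
  using poly_on.coord[OF _ poly_on.const[of Y L 0 1], of l] by simp

lemma poly_on_mult:
  assumes "poly_on Y L d f" "poly_on Y L e h"
  shows "poly_on Y L (d + e) (\<lambda>y. f y * h y)"
  using assms
proof (induction rule: poly_on.induct)
  case (const d c)
  from this have "poly_on Y L e (\<lambda>y. c * h y)"
  proof (induction rule: poly_on.induct)
    case (add d f h)
    then show ?case by (auto simp: distrib_left intro: poly_on.add)
  next
    case (coord l d f)
    from poly_on.coord[OF coord(1) coord(3)] show ?case by (simp add: mult.left_commute)
  next
    case (cong d f h)
    then show ?case by (auto intro: poly_on.cong)
  qed (auto intro: poly_on.const)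
  then show ?case by (auto intro: poly_on_mono)
next
  case (add d f g)
  then show ?case by (auto simp: distrib_right intro: poly_on.add)
next
  case (coord l d f)
  from poly_on.coord[OF coord(1) coord(3)[OF coord(4)]] show ?case by (simp add: mult.assoc)
next
  case (cong d f g)
  then show ?case by (auto intro: poly_on.cong)
qed

lemma poly_on_cmult: "poly_on Y L d f \<Longrightarrow> poly_on Y L d (\<lambda>y. c * f y)"
  using poly_on_mult[OF poly_on.const[of Y L 0 c]] by simp

lemma poly_on_sum:
  assumes "\<And>i. i \<in> I \<Longrightarrow> poly_on Y L d (f i)"
  shows "poly_on Y L d (\<lambda>y. \<Sum>i\<in>I. f i y)"
  using assms by (induction I rule: infinite_finite_induct) (auto intro: poly_on.intros)

lemma poly_on_prod:
  assumes "\<And>i. i \<in> I \<Longrightarrow> poly_on Y L (d i) (f i)"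
  shows "poly_on Y L (\<Sum>i\<in>I. d i) (\<lambda>y. \<Prod>i\<in>I. f i y)"
  using assms
  by (induction I rule: infinite_finite_induct) (auto intro: poly_on.const poly_on_mult)

lemma poly_on_power: "poly_on Y L d f \<Longrightarrow> poly_on Y L (k * d) (\<lambda>y. f y ^ k)"
  by (induction k) (auto intro: poly_on.const poly_on_mult)

lemma poly_on_subst:
  assumes "poly_on Y L d f"
    and "\<And>l. l \<in> L \<Longrightarrow> poly_on Y' L' (Suc 0) (\<lambda>z. l (\<phi> z))"
    and "\<And>z. z \<in> Y' \<Longrightarrow> \<phi> z \<in> Y"
  shows "poly_on Y' L' d (\<lambda>z. f (\<phi> z))"
  using assms(1)
proof (induction rule: poly_on.induct)
  case (coord l d f)
  from poly_on_mult[OF assms(2)[OF coord(1)] coord(3)] show ?case by simp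
next
  case (cong d f h)
  then show ?case using assms(3) by (auto intro: poly_on.cong)
qed (auto intro: poly_on.intros)

text \<open>
  The discrete antiderivative raises the degree by one. In the basis of the binomial coefficients
  \<open>t gchoose j\<close> it is Pascal's rule, and multiplication by \<open>t\<close> is also explicit, so the polynomials
  in \<open>(b, t)\<close> are first rewritten in this basis.
\<close>

inductive gchoose_sum :: "'a set \<Rightarrow> ('a \<Rightarrow> real) set \<Rightarrow> nat \<Rightarrow> ('a \<times> int \<Rightarrow> real) \<Rightarrow> bool"
  for Y :: "'a set" and L :: "('a \<Rightarrow> real) set" where
  base: "poly_on Y L i c \<Longrightarrow> i + j \<le> d \<Longrightarrow>
    gchoose_sum Y L d (\<lambda>z. c (fst z) * (real_of_int (snd z) gchoose j))"
| add: "gchoose_sum Y L d f \<Longrightarrow> gchoose_sum Y L d h \<Longrightarrow> gchoose_sum Y L d (\<lambda>z. f z + h z)"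
| cong: "gchoose_sum Y L d f \<Longrightarrow> (\<And>y t. y \<in> Y \<Longrightarrow> f (y, t) = h (y, t)) \<Longrightarrow> gchoose_sum Y L d h"

abbreviation coords_with_time :: "('a \<Rightarrow> real) set \<Rightarrow> ('a \<times> int \<Rightarrow> real) set" where
  "coords_with_time L \<equiv> insert (\<lambda>z. real_of_int (snd z)) ((\<lambda>l z. l (fst z)) ` L)"

lemma gchoose_sum_coord:
  assumes "gchoose_sum Y L d f" "l \<in> L"
  shows "gchoose_sum Y L (Suc d) (\<lambda>z. l (fst z) * f z)"
  using assms
proof (induction rule: gchoose_sum.induct)
  case (base i c j d)
  from gchoose_sum.base[OF poly_on.coord[OF base(3) base(1)], of j "Suc d"] base(2)
  show ?case by (simp add: mult.assoc)
next
  case (add d f h)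
  then show ?case by (auto simp: distrib_left intro: gchoose_sum.add)
next
  case (cong d f h)
  then show ?case by (auto intro: gchoose_sum.cong)
qed

lemma gchoose_sum_time:
  assumes "gchoose_sum Y L d f"
  shows "gchoose_sum Y L (Suc d) (\<lambda>z. real_of_int (snd z) * f z)"
  using assms
proof (induction rule: gchoose_sum.induct)
  case (base i c j d)
  have "gchoose_sum Y L (Suc d) (\<lambda>z. (real j * c (fst z)) * (real_of_int (snd z) gchoose j) +
          (real (Suc j) * c (fst z)) * (real_of_int (snd z) gchoose Suc j))"
    by (intro gchoose_sum.add gchoose_sum.base[where i = i] poly_on_cmult base(1))
      (use base(2) in auto)
  moreover have "(real j * c y) * (real_of_int t gchoose j) + (real (Suc j) * c y) * (real_of_int t gchoose Suc j)
     = real_of_int t * (c y * (real_of_int t gchoose j))" for y t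
    using gbinomial_mult_1[of "real_of_int t" j] by algebra
  ultimately show ?case
    by (auto intro: gchoose_sum.cong)
next
  case (add d f h)
  then show ?case by (auto simp: distrib_left intro: gchoose_sum.add)
next
  case (cong d f h)
  then show ?case by (auto intro: gchoose_sum.cong)
qed

lemma poly_on_imp_gchoose_sum:
  assumes "poly_on (Y \<times> UNIV) (coords_with_time L) d f"
  shows "gchoose_sum Y L d f"
  using assms
proof (induction rule: poly_on.induct)
  case (const d c)
  from gchoose_sum.base[OF poly_on.const[of Y L 0 c], of 0 d] show ?case by simp
next
  case (coord l d f)
  then show ?case using gchoose_sum_coord[OF coord(3)] gchoose_sum_time[OF coord(3)] by auto
next
  case (cong d f h)
  then show ?case by (auto intro: gchoose_sum.cong)
qed (auto intro: gchoose_sum.intros)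

lemma poly_on_gchoose:
  assumes "(\<lambda>z. real_of_int (\<tau> z)) \<in> L"
  shows "poly_on Y L j (\<lambda>z. real_of_int (\<tau> z) gchoose j)"
proof (induction j)
  case 0
  show ?case by (simp add: poly_on.const)
next
  case (Suc j)
  have "poly_on Y L (1 + j) (\<lambda>z. (1 / real (Suc j) * (real_of_int (\<tau> z) + (- real j))) * (real_of_int (\<tau> z) gchoose j))"
    by (intro poly_on_mult poly_on_cmult poly_on.add poly_on.const Suc)
      (use poly_on_coord[OF assms] in auto)
  moreover have "(1 / real (Suc j) * (x + (- real j))) * (x gchoose j) = x gchoose Suc j" for x :: real
    using gbinomial_mult_1[of x j] by (simp add: field_simps)
  ultimately show ?case by simp
qed

lemma poly_on_antiderivative:
  assumes "poly_on (Y \<times> UNIV) (coords_with_time L) d f"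
  shows "\<exists>F. poly_on (Y \<times> UNIV) (coords_with_time L) (Suc d) F \<and>
            (\<forall>y\<in>Y. \<forall>t. f (y, t) = F (y, t + 1) - F (y, t))"
  using poly_on_imp_gchoose_sum[OF assms]
proof (induction rule: gchoose_sum.induct)
  case (base i c j d)
  have "poly_on (Y \<times> UNIV) (coords_with_time L) (i + Suc j)
          (\<lambda>z. c (fst z) * (real_of_int (snd z) gchoose Suc j))"
  proof (rule poly_on_mult)
    show "poly_on (Y \<times> UNIV) (coords_with_time L) i (\<lambda>z. c (fst z))"
      by (rule poly_on_subst[OF base(1)]) (auto intro: poly_on_coord)
    show "poly_on (Y \<times> UNIV) (coords_with_time L) (Suc j) (\<lambda>z. real_of_int (snd z) gchoose Suc j)"
      by (rule poly_on_gchoose) simp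
  qed
  then have "poly_on (Y \<times> UNIV) (coords_with_time L) (Suc d)
          (\<lambda>z. c (fst z) * (real_of_int (snd z) gchoose Suc j))"
    by (rule poly_on_mono) (use base(2) in simp)
  then show ?case
    by (intro exI conjI) (auto simp: gbinomial_Suc_Suc distrib_left)
next
  case (add d f h)
  then obtain F H where "poly_on (Y \<times> UNIV) (coords_with_time L) (Suc d) F"
    "poly_on (Y \<times> UNIV) (coords_with_time L) (Suc d) H"
    "\<forall>y\<in>Y. \<forall>t. f (y, t) = F (y, t + 1) - F (y, t)" "\<forall>y\<in>Y. \<forall>t. h (y, t) = H (y, t + 1) - H (y, t)"
    by blast
  then show ?case by (intro exI[of _ "\<lambda>z. F z + H z"]) (auto intro: poly_on.add)
next
  case (cong d f h)
  then show ?case by metis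
qed

section \<open>Cross-free families of cuts\<close>

definition cross_free :: "'v set \<Rightarrow> 'v set \<Rightarrow> 'v set \<Rightarrow> bool" where
  "cross_free V S T \<longleftrightarrow> S \<subseteq> T \<or> T \<subseteq> S \<or> S \<inter> T = {} \<or> V \<subseteq> S \<union> T"

text \<open>
  On vectors of sum \<open>0\<close>, a cut and its complement have opposite values. Both are kept, so that
  either of them may stand for the cut.
\<close>
definition cut_family :: "'v set \<Rightarrow> 'v set set \<Rightarrow> bool" where
  "cut_family V \<C> \<longleftrightarrow> finite \<C> \<and> \<C> \<subseteq> Pow V \<and> (\<forall>S\<in>\<C>. V - S \<in> \<C>) \<and>
     (\<forall>S\<in>\<C>. \<forall>T\<in>\<C>. cross_free V S T)"

definition separates :: "'v \<Rightarrow> 'v \<Rightarrow> 'v set \<Rightarrow> bool" where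
  "separates u v S \<longleftrightarrow> (u \<in> S) \<noteq> (v \<in> S)"

text \<open>
  The signs of the values at \<open>b - b(T) (u - v)\<close> of the cuts in \<open>\<C>\<close> are signs of values at \<open>b\<close> of
  cuts in the pivoted family; the cut \<open>T\<close> itself is kept because \<open>b(T)\<close> is the weight of the edge.
\<close>
definition pivot :: "'v set \<Rightarrow> 'v \<Rightarrow> 'v \<Rightarrow> 'v set \<Rightarrow> 'v set set \<Rightarrow> 'v set set" where
  "pivot V u v T \<C> = {T, V - T} \<union>
     (\<lambda>S. if separates u v S then (S - T) \<union> (T - S) else S) ` \<C>"

text \<open>
  The empty set is included because its value \<open>0\<close> is the breakpoint at the lower end of the
  summation over the weight of an edge from \<open>u\<close> to \<open>v\<close>.
\<close>
definition cut_chain :: "'v \<Rightarrow> 'v \<Rightarrow> 'v set set \<Rightarrow> 'v set set" where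
  "cut_chain u v \<C> = insert {} {S \<in> \<C>. u \<in> S \<and> v \<notin> S}"

lemma cross_free_sym: "cross_free V S T \<Longrightarrow> cross_free V T S"
  by (auto simp: cross_free_def)

lemma cross_free_compl: "S \<subseteq> V \<Longrightarrow> T \<subseteq> V \<Longrightarrow> cross_free V (V - S) T \<longleftrightarrow> cross_free V S T"
  unfolding cross_free_def by blast

lemma cut_familyD:
  assumes "cut_family V \<C>"
  shows "finite \<C>" "S \<in> \<C> \<Longrightarrow> S \<subseteq> V" "S \<in> \<C> \<Longrightarrow> V - S \<in> \<C>"
    "S \<in> \<C> \<Longrightarrow> T \<in> \<C> \<Longrightarrow> cross_free V S T"
  using assms by (auto simp: cut_family_def)

lemma chain_nested:
  assumes "cut_family V \<C>" "S \<in> cut_chain u v \<C>" "T \<in> cut_chain u v \<C>" "u \<in> V" "v \<in> V"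
  shows "S \<subseteq> T \<or> T \<subseteq> S"
proof (cases "S = {} \<or> T = {}")
  case False
  with assms(2,3) have *: "S \<in> \<C>" "T \<in> \<C>" "u \<in> S" "u \<in> T" "v \<notin> S" "v \<notin> T"
    by (auto simp: cut_chain_def)
  from cut_familyD(4)[OF assms(1) *(1,2)] * assms(5) show ?thesis
    unfolding cross_free_def by blast
qed auto

lemma cut_family_insert_singleton:
  assumes "cut_family V \<C>" "u \<in> V"
  shows "cut_family V ({{u}, V - {u}} \<union> \<C>)"
proof -
  have a: "cross_free V {u} S" if "S \<in> \<C>" for S
    using that by (auto simp: cross_free_def)
  have b: "cross_free V (V - {u}) S" if "S \<in> \<C>" for S
    using a[OF that] cross_free_compl[of "{u}" V S] assms(2) cut_familyD(2)[OF assms(1) that] by auto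
  show ?thesis
    using assms a b cross_free_sym[OF a] cross_free_sym[OF b] unfolding cut_family_def
    by (auto simp: double_diff) (auto simp: cross_free_def)
qed

text \<open>
  All cuts that contain \<open>u\<close> and miss \<open>v\<close> form a chain, and a cut that does not separate \<open>u\<close> from
  \<open>v\<close> lies, up to complement, in one gap of the chain. Hence replacing each \<open>S\<close> in the
  chain by its difference to a fixed member \<open>T\<close> creates no crossing. For the fundamental cuts of a
  spanning tree this is the exchange of a tree edge for the edge from \<open>u\<close> to \<open>v\<close>.
\<close>
lemma cut_family_pivot:
  assumes fam: "cut_family V \<C>" and uv: "u \<in> V" "v \<in> V" and T: "T \<in> cut_chain u v \<C>"
  shows "cut_family V (pivot V u v T \<C>)"
proof -
  let ?sd = "\<lambda>S. (S - T) \<union> (T - S)"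
  have TV: "T \<subseteq> V" using T cut_familyD(2)[OF fam] by (auto simp: cut_chain_def)
  have nested: "S \<subseteq> S' \<or> S' \<subseteq> S" if "S \<in> cut_chain u v \<C>" "S' \<in> cut_chain u v \<C>" for S S'
    using chain_nested[OF fam that uv] .
  have toV: "S \<subseteq> V" if "S \<in> \<C>" for S using cut_familyD(2)[OF fam that] .
  \<comment> \<open>Up to complement, a separating cut is in the chain and its image is a difference of two members.\<close>
  have sep: "\<exists>S'\<in>cut_chain u v \<C>. ?sd S = ?sd S' \<or> ?sd S = V - ?sd S'"
    if S: "S \<in> \<C>" "separates u v S" for S
  proof (cases "u \<in> S")
    case True
    with S have "S \<in> cut_chain u v \<C>" by (auto simp: separates_def cut_chain_def)
    then show ?thesis by blast
  next
    case False
    with S uv cut_familyD(3)[OF fam S(1)] have "V - S \<in> cut_chain u v \<C>"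
      by (auto simp: separates_def cut_chain_def)
    moreover have "?sd S = V - ?sd (V - S)" using toV[OF S(1)] TV by blast
    ultimately show ?thesis by blast
  qed
  have chainV: "S \<subseteq> V" if "S \<in> cut_chain u v \<C>" for S
    using that toV by (auto simp: cut_chain_def)
  have gap: "cross_free V (?sd S) R" if S: "S \<in> cut_chain u v \<C>" and R: "R \<in> \<C>" "\<not> separates u v R" for S R
  proof -
    have gap0: "cross_free V (?sd S) R" if "R \<in> \<C>" "u \<notin> R" "v \<notin> R" for R
    proof -
      have "R \<subseteq> S' \<or> R \<inter> S' = {}" if "S' \<in> cut_chain u v \<C>" for S'
      proof (cases "S' = {}")
        case False
        with that have "S' \<in> \<C>" "u \<in> S'" "v \<notin> S'" by (auto simp: cut_chain_def)
        with \<open>R \<in> \<C>\<close> \<open>u \<notin> R\<close> \<open>v \<notin> R\<close> cut_familyD(4)[OF fam, of S' R] uv show ?thesis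
          unfolding cross_free_def by blast
      qed auto
      from this[OF S] this[OF T] nested[OF S T] show ?thesis
        unfolding cross_free_def by blast
    qed
    show ?thesis
    proof (cases "u \<in> R")
      case True
      with R have "cross_free V (?sd S) (V - R)"
        by (intro gap0 cut_familyD(3)[OF fam]) (auto simp: separates_def)
      then show ?thesis
        using cross_free_compl[of R V "?sd S"] toV[OF R(1)] chainV[OF S] TV cross_free_sym
        by (metis Diff_subset Un_least order_trans)
    next
      case False
      with R show ?thesis by (intro gap0) (auto simp: separates_def)
    qed
  qed
  have two: "cross_free V (?sd S) (?sd S')" if "S \<in> cut_chain u v \<C>" "S' \<in> cut_chain u v \<C>" for S S'
    using nested[OF that] nested[OF that(1) T] nested[OF that(2) T]
    unfolding cross_free_def by blast
  have TE: "T = ?sd {}" "V - T = V - ?sd {}" "{} \<in> cut_chain u v \<C>" by (auto simp: cut_chain_def)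
  define good where "good = {X. X \<subseteq> V \<and> ((X \<in> \<C> \<and> \<not> separates u v X) \<or>
      (\<exists>S\<in>cut_chain u v \<C>. X = ?sd S \<or> X = V - ?sd S))}"
  have piv: "pivot V u v T \<C> \<subseteq> good"
    unfolding pivot_def good_def using TE TV sep toV by (auto; blast)
  have sdV: "?sd S \<subseteq> V" if "S \<in> cut_chain u v \<C>" for S using chainV[OF that] TV by blast
  have cf1: "cross_free V X (?sd S)" if X: "X \<in> good" and S: "S \<in> cut_chain u v \<C>" for X S
  proof -
    consider "X \<in> \<C>" "\<not> separates u v X"
      | S' where "S' \<in> cut_chain u v \<C>" "X = ?sd S' \<or> X = V - ?sd S'"
      using X by (auto simp: good_def)
    then show ?thesis
    proof cases
      case 1
      then show ?thesis by (intro cross_free_sym[OF gap[OF S]])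
    next
      case (2 S')
      then show ?thesis
        using two[OF 2(1) S] cross_free_compl[OF sdV[OF 2(1)] sdV[OF S]] by metis
    qed
  qed
  have cf: "cross_free V X X'" if X: "X \<in> good" and X': "X' \<in> good" for X X'
  proof -
    consider "X' \<in> \<C>" "\<not> separates u v X'" | S where "S \<in> cut_chain u v \<C>" "X' = ?sd S \<or> X' = V - ?sd S"
      using X' by (auto simp: good_def)
    then show ?thesis
    proof cases
      case 1
      consider "X \<in> \<C>" | S where "S \<in> cut_chain u v \<C>" "X = ?sd S \<or> X = V - ?sd S"
        using X by (auto simp: good_def)
      then show ?thesis
      proof cases
        case 1
        then show ?thesis using cut_familyD(4)[OF fam] \<open>X' \<in> \<C>\<close> by blast
      next
        case (2 S)
        have "cross_free V (?sd S) X'" by (rule gap[OF 2(1) 1])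
        then show ?thesis using 2(2) cross_free_compl[OF sdV[OF 2(1)] toV[OF 1(1)]] by metis
      qed
    next
      case (2 S)
      have "cross_free V (?sd S) X" by (rule cross_free_sym[OF cf1[OF X 2(1)]])
      moreover have "X \<subseteq> V" using X by (simp add: good_def)
      ultimately have "cross_free V X' X"
        using 2(2) cross_free_compl[OF sdV[OF 2(1)]] by metis
      then show ?thesis by (rule cross_free_sym)
    qed
  qed
  have compl: "V - X \<in> pivot V u v T \<C>" if X: "X \<in> pivot V u v T \<C>" for X
  proof -
    let ?f = "\<lambda>S. if separates u v S then ?sd S else S"
    have image: "?f S \<in> pivot V u v T \<C>" if "S \<in> \<C>" for S
      unfolding pivot_def by (rule UnI2, rule image_eqI[where x = S]) (rule refl, rule that)
    from X have "X \<in> {T, V - T} \<or> X \<in> ?f ` \<C>" unfolding pivot_def by (rule UnE) simp_all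
    then show ?thesis
    proof
      assume "X \<in> {T, V - T}"
      then have "V - X \<in> {T, V - T}" using TV by auto
      then show ?thesis unfolding pivot_def by (rule UnI1)
    next
      assume "X \<in> ?f ` \<C>"
      then obtain S where S: "S \<in> \<C>" "X = ?f S" by (rule imageE)
      have "separates u v (V - S) = separates u v S" using uv by (simp add: separates_def)
      moreover have "V - ?sd S = ?sd (V - S)" using toV[OF S(1)] TV by blast
      ultimately have "V - X = ?f (V - S)" using S(2) by simp
      then show ?thesis using image[OF cut_familyD(3)[OF fam S(1)]] by simp
    qed
  qed
  have "finite (pivot V u v T \<C>)" using cut_familyD(1)[OF fam] by (simp add: pivot_def)
  moreover have "pivot V u v T \<C> \<subseteq> Pow V"
    using piv by (rule order_trans) (simp add: good_def subset_iff)
  ultimately show ?thesis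
    unfolding cut_family_def using compl cf[OF subsetD[OF piv] subsetD[OF piv]] by blast
qed

section \<open>Summation by parts\<close>

text \<open>
  A function \<open>\<eta>\<close> of half-integers (\<open>\<eta> s\<close> is the value at \<open>s / 2\<close>) that is constant between
  the breakpoints \<open>B\<close> changes only next to breakpoints. Abel summation therefore turns
  the sum of a difference \<open>G (t + 1) - G t\<close>, weighted by \<open>\<eta>\<close>, into terms at single breakpoints.
  The neighbours of a breakpoint, which depend on the order of all of them, do not enter. The
  value at a half-integer stands for the one on the open interval next to a breakpoint.
\<close>
lemma sum_by_breakpoints:
  fixes G \<eta> :: "int \<Rightarrow> real" and B :: "int set"
  assumes "finite B"
    and step: "\<And>s s'. (\<And>c. c \<in> B \<Longrightarrow> sgn (s - 2 * c) = sgn (s' - 2 * c)) \<Longrightarrow> \<eta> s = \<eta> s'"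
    and supp: "\<And>s. s \<le> 0 \<or> s > 2 * N \<Longrightarrow> \<eta> s = 0"
  shows "(\<Sum>t\<in>{1..N}. (G (t + 1) - G t) * \<eta> (2 * t)) =
    (\<Sum>c\<in>B. G c * (\<eta> (2 * c - 1) - \<eta> (2 * c)) + G (c + 1) * (\<eta> (2 * c) - \<eta> (2 * c + 1)))"
proof -
  obtain M0 where M0: "\<And>c. c \<in> B \<Longrightarrow> \<bar>c\<bar> \<le> M0"
    using \<open>finite B\<close> by (metis finite_imageI Max_ge image_eqI)
  define M where "M = nat (max (max M0 N) 1)"
  have MB: "B \<subseteq> {-int M..int M}" and MN: "{1..N} \<subseteq> {-int M..int M}" "N \<le> int M" "0 < M"
    using M0 unfolding M_def by (force simp: abs_le_iff)+
  have jump1: "\<eta> (2 * t - 1) = \<eta> (2 * t)" if "t \<notin> B" for t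
  proof (rule step)
    fix c assume "c \<in> B"
    with that have "c < t \<or> t < c" by (metis linorder_less_linear)
    then show "sgn (2 * t - 1 - 2 * c) = sgn (2 * t - 2 * c)" by (auto simp: sgn_if)
  qed
  have jump2: "\<eta> (2 * t) = \<eta> (2 * t + 1)" if "t \<notin> B" for t
  proof (rule step)
    fix c assume "c \<in> B"
    with that have "c < t \<or> t < c" by (metis linorder_less_linear)
    then show "sgn (2 * t - 2 * c) = sgn (2 * t + 1 - 2 * c)" by (auto simp: sgn_if)
  qed
  have tele: "(\<Sum>t\<in>{-int m..int m}. H (t + 1) - H t) = H (int m + 1) - H (- int m)"
    for H :: "int \<Rightarrow> real" and m :: nat
  proof (induction m)
    case (Suc m)
    have "{-int (Suc m)..int (Suc m)} = insert (int m + 1) (insert (- int m - 1) {-int m..int m})"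
      by auto
    then have "(\<Sum>t\<in>{-int (Suc m)..int (Suc m)}. H (t + 1) - H t) =
      (H (int m + 1 + 1) - H (int m + 1)) + ((H (- int m - 1 + 1) - H (- int m - 1)) +
        (\<Sum>t\<in>{-int m..int m}. H (t + 1) - H t))"
      by simp
    also have "\<dots> = H (int m + 1 + 1) - H (- int m - 1)" using Suc.IH by simp
    also have "int m + 1 + 1 = int (Suc m) + 1" by simp
    also have "- int m - 1 = - int (Suc m)" by simp
    finally show ?case .
  qed simp
  have "(\<Sum>c\<in>B. G c * (\<eta> (2 * c - 1) - \<eta> (2 * c)) + G (c + 1) * (\<eta> (2 * c) - \<eta> (2 * c + 1))) =
    (\<Sum>t\<in>{-int M..int M}. G t * (\<eta> (2 * t - 1) - \<eta> (2 * t)) + G (t + 1) * (\<eta> (2 * t) - \<eta> (2 * t + 1)))"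
    by (rule sum.mono_neutral_left) (use MB in \<open>auto simp: jump1 jump2[symmetric]\<close>)
  also have "\<dots> = (\<Sum>t\<in>{-int M..int M}. (G (t + 1) - G t) * \<eta> (2 * t)) -
      (\<Sum>t\<in>{-int M..int M}. G (t + 1) * \<eta> (2 * (t + 1) - 1) - G t * \<eta> (2 * t - 1))"
    unfolding sum_subtractf[symmetric] by (intro sum.cong) (auto simp: algebra_simps)
  also have "(\<Sum>t\<in>{-int M..int M}. G (t + 1) * \<eta> (2 * (t + 1) - 1) - G t * \<eta> (2 * t - 1)) = 0"
    by (subst tele[of "\<lambda>t. G t * \<eta> (2 * t - 1)"]) (use MN in \<open>simp add: supp\<close>)
  also have "(\<Sum>t\<in>{-int M..int M}. (G (t + 1) - G t) * \<eta> (2 * t)) =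
      (\<Sum>t\<in>{1..N}. (G (t + 1) - G t) * \<eta> (2 * t))"
    by (rule sum.mono_neutral_right) (use MN in \<open>auto simp: supp\<close>)
  finally show ?thesis by simp
qed

text \<open>
  Several cuts may have the same value. Giving each of them an equal share avoids a choice
  between them that would depend on \<open>b\<close>.
\<close>
lemma sum_image_weighted:
  fixes H :: "'b \<Rightarrow> real"
  assumes "finite A"
  shows "(\<Sum>x\<in>c ` A. H x) = (\<Sum>T\<in>A. H (c T) / real (card {T' \<in> A. c T' = c T}))"
proof -
  have "(\<Sum>T\<in>A. H (c T) / real (card {T' \<in> A. c T' = c T})) =
      (\<Sum>x\<in>c ` A. \<Sum>T\<in>{T \<in> A. c T = x}. H (c T) / real (card {T' \<in> A. c T' = c T}))"
    using assms by (rule sum.image_gen)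
  also have "\<dots> = (\<Sum>x\<in>c ` A. H x)"
  proof (rule sum.cong)
    fix x assume "x \<in> c ` A"
    then have "card {T \<in> A. c T = x} > 0" using assms by (auto simp: card_gt_0_iff)
    moreover have "(\<Sum>T\<in>{T \<in> A. c T = x}. H (c T) / real (card {T' \<in> A. c T' = c T})) =
      (\<Sum>T\<in>{T \<in> A. c T = x}. H x / real (card {T \<in> A. c T = x}))"
      by (intro sum.cong) auto
    ultimately show "(\<Sum>T\<in>{T \<in> A. c T = x}. H (c T) / real (card {T' \<in> A. c T' = c T})) = H x"
      by simp
  qed auto
  finally show ?thesis by simp
qed

section \<open>Functions that are polynomial on the cells of cut families\<close>

definition zero_sum :: "'v set \<Rightarrow> ('v \<Rightarrow> int) set" where
  "zero_sum V = {b. sum b V = 0}"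

definition vertex_coords :: "'v set \<Rightarrow> (('v \<Rightarrow> int) \<Rightarrow> real) set" where
  "vertex_coords V = (\<lambda>v b. real_of_int (b v)) ` V"

definition sign_determined :: "'v set \<Rightarrow> 'v set set \<Rightarrow> (('v \<Rightarrow> int) \<Rightarrow> real) \<Rightarrow> bool" where
  "sign_determined V \<C> \<kappa> \<longleftrightarrow> (\<forall>b\<in>zero_sum V. \<forall>b'\<in>zero_sum V.
     (\<forall>S\<in>\<C>. sgn (sum b S) = sgn (sum b' S)) \<longrightarrow> \<kappa> b = \<kappa> b')"

text \<open>
  The family \<open>\<C>\<close> of signs may differ from summand to summand. Only \<open>\<D>\<close> is common to
  all of them; it will be the set of connected components.
\<close>
inductive cut_polynomial ::
  "'v set \<Rightarrow> 'v set set \<Rightarrow> nat \<Rightarrow> (('v \<Rightarrow> int) \<Rightarrow> real) \<Rightarrow> bool"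
  for V :: "'v set" and \<D> :: "'v set set" and D :: nat where
  piece: "cut_family V \<C> \<Longrightarrow> \<D> \<subseteq> \<C> \<Longrightarrow> sign_determined V \<C> \<kappa> \<Longrightarrow>
    poly_on (zero_sum V) (vertex_coords V) D P \<Longrightarrow> cut_polynomial V \<D> D (\<lambda>b. \<kappa> b * P b)"
| zero: "cut_polynomial V \<D> D (\<lambda>b. 0)"
| add: "cut_polynomial V \<D> D F \<Longrightarrow> cut_polynomial V \<D> D H \<Longrightarrow> cut_polynomial V \<D> D (\<lambda>b. F b + H b)"
| cong: "cut_polynomial V \<D> D F \<Longrightarrow> (\<And>b. b \<in> zero_sum V \<Longrightarrow> F b = H b) \<Longrightarrow> cut_polynomial V \<D> D H"

lemma cut_polynomial_sum:
  assumes "\<And>i. i \<in> I \<Longrightarrow> cut_polynomial V \<D> D (F i)"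
  shows "cut_polynomial V \<D> D (\<lambda>b. \<Sum>i\<in>I. F i b)"
  using assms by (induction I rule: infinite_finite_induct)
    (auto intro: cut_polynomial.zero cut_polynomial.add)

definition shift :: "'v \<Rightarrow> 'v \<Rightarrow> int \<Rightarrow> ('v \<Rightarrow> int) \<Rightarrow> 'v \<Rightarrow> int" where
  "shift u v t b = (\<lambda>w. b w - (if w = u then t else 0) + (if w = v then t else 0))"

lemma sum_shift:
  assumes "finite S"
  shows "sum (shift u v t b) S = sum b S - (if u \<in> S then t else 0) + (if v \<in> S then t else 0)"
  using assms by (simp add: shift_def sum.distrib sum_subtractf)

lemma shift_zero_sum:
  "finite V \<Longrightarrow> u \<in> V \<Longrightarrow> v \<in> V \<Longrightarrow> b \<in> zero_sum V \<Longrightarrow> shift u v t b \<in> zero_sum V"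
  by (simp add: zero_sum_def sum_shift)

lemma sum_compl_zero_sum:
  assumes "finite V" "b \<in> zero_sum V" "S \<subseteq> V"
  shows "sum b (V - S) = - sum b S"
  using assms sum.subset_diff[of S V b] by (simp add: zero_sum_def)

lemma sum_nested_diff:
  fixes b :: "'v \<Rightarrow> int"
  assumes "finite S" "finite T" "S \<subseteq> T \<or> T \<subseteq> S"
  shows "sum b ((S - T) \<union> (T - S)) = (if T \<subseteq> S then 1 else -1) * (sum b S - sum b T)"
proof (cases "T \<subseteq> S")
  case True
  then have "(S - T) \<union> (T - S) = S - T" by auto
  then show ?thesis using True assms sum_diff[of S T b] by simp
next
  case False
  with assms have "S \<subseteq> T" by auto
  then have "(S - T) \<union> (T - S) = T - S" by auto
  then show ?thesis using False \<open>S \<subseteq> T\<close> assms sum_diff[of T S b] by simp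
qed

lemma poly_on_vertex:
  "v \<in> V \<Longrightarrow> poly_on Y (vertex_coords V) (Suc 0) (\<lambda>b. real_of_int (b v))"
  by (rule poly_on_coord) (simp add: vertex_coords_def)

lemma poly_on_cut:
  assumes "S \<subseteq> V"
  shows "poly_on Y (vertex_coords V) (Suc 0) (\<lambda>b. real_of_int (sum b S))"
  using assms by (auto simp: of_int_sum intro!: poly_on_sum poly_on_vertex)

lemma sgn_half_step:
  fixes z z' e :: int
  assumes "sgn z = sgn z'" "e \<in> {-1, 0, 1}"
  shows "sgn (2 * z + e) = sgn (2 * z' + e)"
  using assms by (auto simp: sgn_if split: if_splits; presburger)

lemma sgn_twice: "sgn (2 * a) = sgn (a :: int)"
  by (simp add: sgn_mult)

lemma sgn_chain_diff:
  fixes b b' :: "'v \<Rightarrow> int"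
  assumes V: "finite V" and fam: "cut_family V \<C>" and uv: "u \<in> V" "v \<in> V"
    and S: "S \<in> cut_chain u v \<C>" and T: "T \<in> cut_chain u v \<C>"
    and eq: "\<And>S. S \<in> pivot V u v T \<C> \<Longrightarrow> sgn (sum b S) = sgn (sum b' S)"
  shows "sgn (sum b S - sum b T) = sgn (sum b' S - sum b' T)"
proof (cases "S = {}")
  case True
  have "sgn (sum b T) = sgn (sum b' T)" using eq by (simp add: pivot_def)
  then show ?thesis using True by simp
next
  case False
  with S have SC: "S \<in> \<C>" "separates u v S" by (auto simp: cut_chain_def separates_def)
  then have "(S - T) \<union> (T - S) \<in> pivot V u v T \<C>" unfolding pivot_def by force
  then have "sgn (sum b ((S - T) \<union> (T - S))) = sgn (sum b' ((S - T) \<union> (T - S)))" by (rule eq)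
  moreover have "finite S" "finite T"
    using V T SC(1) cut_familyD(2)[OF fam] by (auto simp: cut_chain_def intro: finite_subset)
  ultimately show ?thesis
    using sum_nested_diff[of S T b] sum_nested_diff[of S T b'] chain_nested[OF fam S T uv]
    by (auto simp: sgn_mult split: if_splits)
qed

text \<open>
  Moving along \<open>u - v\<close> by \<open>t\<close> lowers the values of the cuts with \<open>u\<close> inside and \<open>v\<close> outside by \<open>t\<close>.
  So at \<open>t = b(T)\<close> their signs become comparisons of \<open>b(S)\<close> with \<open>b(T)\<close>, and because the
  chain is nested these are signs of cuts of the pivoted family. Half-integers are cleared by
  doubling; for integers \<open>z\<close> the sign of \<open>2 z \<pm> 1\<close> is determined by that of \<open>z\<close>.
\<close>
lemma sign_determined_pivot:
  assumes V: "finite V" and fam: "cut_family V \<C>" and uv: "u \<in> V" "v \<in> V"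
    and T: "T \<in> cut_chain u v \<C>" and \<kappa>: "sign_determined V \<C> \<kappa>"
    and e: "e \<in> {-1, 0, 1}"
  shows "sign_determined V (pivot V u v T \<C>) (\<lambda>b. \<kappa> (shift u v (2 * sum b T + e) (\<lambda>w. 2 * b w)))"
  unfolding sign_determined_def
proof (intro ballI impI)
  fix b b' assume b: "b \<in> zero_sum V" and b': "b' \<in> zero_sum V"
    and eq: "\<forall>S\<in>pivot V u v T \<C>. sgn (sum b S) = sgn (sum b' S)"
  have cmp: "sgn (sum b S - sum b T) = sgn (sum b' S - sum b' T)" if "S \<in> cut_chain u v \<C>" for S
    by (rule sgn_chain_diff[OF V fam uv that T]) (use eq in blast)
  have cmp_e: "sgn (2 * (sum b S - sum b T) - e) = sgn (2 * (sum b' S - sum b' T) - e)"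
    if "S \<in> cut_chain u v \<C>" for S
    using sgn_half_step[OF cmp[OF that], of "- e"] e by auto
  let ?s = "\<lambda>b. shift u v (2 * sum b T + e) (\<lambda>w. 2 * b w)"
  have zs: "?s b \<in> zero_sum V" if "b \<in> zero_sum V" for b :: "'a \<Rightarrow> int"
    using that by (intro shift_zero_sum V uv) (simp add: zero_sum_def sum_distrib_left[symmetric])
  have val: "sum (?s b) S = 2 * (sum b S - sum b T) - e"
    if "u \<in> S" "v \<notin> S" "S \<subseteq> V" for b S
    using that V finite_subset[OF that(3)] by (simp add: sum_shift sum_distrib_left[symmetric])
  have "sgn (sum (?s b) S) = sgn (sum (?s b') S)" if S: "S \<in> \<C>" for S
  proof -
    have SV: "S \<subseteq> V" "finite S" using cut_familyD(2)[OF fam S] V by (auto intro: finite_subset)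
    consider "\<not> separates u v S" | "u \<in> S" "v \<notin> S" | "u \<notin> S" "v \<in> S" by (auto simp: separates_def)
    then show ?thesis
    proof cases
      case 1
      then have "S \<in> pivot V u v T \<C>" using S unfolding pivot_def by force
      with eq 1 SV show ?thesis
        by (auto simp: sum_shift separates_def sum_distrib_left[symmetric] sgn_twice)
    next
      case 2
      then have "S \<in> cut_chain u v \<C>" using S by (auto simp: cut_chain_def)
      from cmp_e[OF this] show ?thesis using val 2 SV by simp
    next
      case 3
      then have "V - S \<in> cut_chain u v \<C>"
        using S uv cut_familyD(3)[OF fam] by (auto simp: cut_chain_def)
      from cmp_e[OF this] val[of "V - S"] 3 uv
      have "sgn (sum (?s b) (V - S)) = sgn (sum (?s b') (V - S))" by auto
      then show ?thesis
        using sum_compl_zero_sum[OF V zs[OF b] SV(1)] sum_compl_zero_sum[OF V zs[OF b'] SV(1)]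
        by simp
    qed
  qed
  with \<kappa> zs[OF b] zs[OF b'] show "\<kappa> (?s b) = \<kappa> (?s b')"
    unfolding sign_determined_def by blast
qed

lemma sign_determined_mono:
  "sign_determined V \<C> \<kappa> \<Longrightarrow> \<C> \<subseteq> \<C>' \<Longrightarrow> sign_determined V \<C>' \<kappa>"
  unfolding sign_determined_def by blast

lemma sign_determined_double:
  assumes "sign_determined V \<C> \<kappa>" "b \<in> zero_sum V"
  shows "\<kappa> (\<lambda>w. 2 * b w) = \<kappa> b"
proof -
  have "(\<lambda>w. 2 * b w) \<in> zero_sum V"
    using assms(2) by (simp add: zero_sum_def sum_distrib_left[symmetric])
  moreover have "sgn (\<Sum>w\<in>S. 2 * b w) = sgn (sum b S)" for S
    by (simp add: sum_distrib_left[symmetric] sgn_twice)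
  ultimately show ?thesis
    using assms unfolding sign_determined_def by blast
qed

lemma sign_determined_op2:
  assumes "sign_determined V \<C> \<kappa>" "sign_determined V \<C> \<kappa>'"
  shows "sign_determined V \<C> (\<lambda>b. f (\<kappa> b) (\<kappa>' b))"
  using assms unfolding sign_determined_def by metis

lemma sign_determined_if:
  assumes "\<And>b b'. b \<in> zero_sum V \<Longrightarrow> b' \<in> zero_sum V \<Longrightarrow>
      (\<And>S. S \<in> \<C> \<Longrightarrow> sgn (sum b S) = sgn (sum b' S)) \<Longrightarrow> Q b \<longleftrightarrow> Q b'"
    and "sign_determined V \<C> \<kappa>"
  shows "sign_determined V \<C> (\<lambda>b. if Q b then \<kappa> b else 0)"
  unfolding sign_determined_def
proof (intro ballI impI)
  fix b b' assume *: "b \<in> zero_sum V" "b' \<in> zero_sum V" "\<forall>S\<in>\<C>. sgn (sum b S) = sgn (sum b' S)"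
  then have "Q b \<longleftrightarrow> Q b'" by (intro assms(1)) auto
  moreover have "\<kappa> b = \<kappa> b'" using assms(2) * unfolding sign_determined_def by blast
  ultimately show "(if Q b then \<kappa> b else 0) = (if Q b' then \<kappa> b' else 0)" by simp
qed

lemma subset_pivot:
  assumes "\<D> \<subseteq> \<C>" "\<And>A. A \<in> \<D> \<Longrightarrow> \<not> separates u v A"
  shows "\<D> \<subseteq> pivot V u v T \<C>"
  using assms unfolding pivot_def by force

text \<open>
  Summation over the weight \<open>t\<close> of an edge between two vertices that are already connected. For
  fixed \<open>b\<close> the summand is, as a function of \<open>t\<close>, a polynomial times a function that jumps only
  at the values \<open>b(T)\<close> of the chain; the singleton \<open>{u}\<close> and the empty set bring the bounds of the sum
  into the chain. Each breakpoint gives a term whose signs are read off the family pivoted at it.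
\<close>
lemma cut_polynomial_edge_sum:
  fixes V :: "'v set"
  assumes V: "finite V" and uv: "u \<in> V" "v \<in> V" "u \<noteq> v"
    and \<D>: "\<And>A. A \<in> \<D> \<Longrightarrow> \<not> separates u v A"
    and F: "cut_polynomial V \<D> D F"
  shows "cut_polynomial V \<D> (Suc (k + D))
           (\<lambda>b. \<Sum>t\<in>{1..b u}. real_of_int t ^ k * F (shift u v t b))"
  using F
proof (induction rule: cut_polynomial.induct)
  case zero
  show ?case by (simp add: cut_polynomial.zero)
next
  case (add F H)
  then show ?case by (auto simp: distrib_left sum.distrib intro: cut_polynomial.add)
next
  case (cong F H)
  show ?case
    by (rule cut_polynomial.cong[OF cong(3)])
      (use cong(2) shift_zero_sum[OF V uv(1,2)] in \<open>auto intro!: sum.cong\<close>)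
next
  case (piece \<C>0 \<kappa> P)
  define \<C> where "\<C> = {{u}, V - {u}} \<union> \<C>0"
  have fam: "cut_family V \<C>"
    unfolding \<C>_def by (rule cut_family_insert_singleton[OF piece(1) uv(1)])
  have \<kappa>: "sign_determined V \<C> \<kappa>"
    using piece(3) by (rule sign_determined_mono) (auto simp: \<C>_def)
  have sub: "\<D> \<subseteq> pivot V u v T \<C>" for T
    using piece(2) \<D> by (intro subset_pivot) (auto simp: \<C>_def)
  have pivot_fam: "cut_family V (pivot V u v T \<C>)" if "T \<in> cut_chain u v \<C>" for T
    by (rule cut_family_pivot[OF fam uv(1,2) that])
  let ?L = "vertex_coords V"
  let ?Z = "zero_sum V \<times> (UNIV :: int set)"
  let ?p = "\<lambda>z. real_of_int (snd z) ^ k * P (shift u v (snd z) (fst z))"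
  have "poly_on ?Z (coords_with_time ?L) (k * Suc 0 + D) ?p"
  proof (intro poly_on_mult poly_on_power)
    show "poly_on ?Z (coords_with_time ?L) (Suc 0) (\<lambda>z. real_of_int (snd z))"
      by (rule poly_on_coord) simp
    show "poly_on ?Z (coords_with_time ?L) D (\<lambda>z. P (shift u v (snd z) (fst z)))"
    proof (rule poly_on_subst[OF piece(4)])
      fix l assume "l \<in> ?L"
      then obtain w where w: "w \<in> V" "l = (\<lambda>b. real_of_int (b w))" by (auto simp: vertex_coords_def)
      have t: "poly_on ?Z (coords_with_time ?L) (Suc 0) (\<lambda>z. c * real_of_int (snd z))" for c
        by (intro poly_on_cmult poly_on_coord) simp
      have "poly_on ?Z (coords_with_time ?L) (Suc 0) (\<lambda>z. real_of_int (fst z w))"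
        by (rule poly_on_coord) (use w in \<open>auto simp: vertex_coords_def\<close>)
      from poly_on.add[OF this t[of "(if w = v then 1 else 0) - (if w = u then 1 else 0)"]]
      show "poly_on ?Z (coords_with_time ?L) (Suc 0) (\<lambda>z. l (shift u v (snd z) (fst z)))"
        by (rule poly_on.cong) (auto simp: w(2) shift_def)
    qed (use V uv in \<open>auto intro: shift_zero_sum\<close>)
  qed
  then obtain G where G: "poly_on ?Z (coords_with_time ?L) (Suc (k + D)) G"
    and pG: "\<And>b t. b \<in> zero_sum V \<Longrightarrow> ?p (b, t) = G (b, t + 1) - G (b, t)"
    using poly_on_antiderivative[of "zero_sum V" ?L "k + D" ?p] by (auto simp del: snd_conv fst_conv)
  define ch where "ch = cut_chain u v \<C>"
  have fin_ch: "finite ch" using cut_familyD(1)[OF fam] by (simp add: ch_def cut_chain_def)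
  have u_ch: "{u} \<in> ch" "{} \<in> ch" using uv by (auto simp: ch_def cut_chain_def \<C>_def)
  have ch_V: "T \<subseteq> V" if "T \<in> ch" for T
    using that cut_familyD(2)[OF fam] by (auto simp: ch_def cut_chain_def)
  define \<eta> where "\<eta> = (\<lambda>b s. if 0 < s \<and> s \<le> 2 * b u then \<kappa> (shift u v s (\<lambda>w. 2 * b w)) else 0)"
  define mult where "mult = (\<lambda>(b :: 'v \<Rightarrow> int) T. real (card {T' \<in> ch. sum b T' = sum b T}))"

  \<comment> \<open>The coefficients at a breakpoint are functions of the signs of the pivoted family.\<close>
  have \<eta>_det: "sign_determined V (pivot V u v T \<C>) (\<lambda>b. \<eta> b (2 * sum b T + e))"
    if T: "T \<in> ch" and e: "e \<in> {-1, 0, 1}" for T e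
    unfolding \<eta>_def
  proof (rule sign_determined_if)
    show "sign_determined V (pivot V u v T \<C>) (\<lambda>b. \<kappa> (shift u v (2 * sum b T + e) (\<lambda>w. 2 * b w)))"
      by (rule sign_determined_pivot[OF V fam uv(1,2) T[unfolded ch_def] \<kappa> e])
    fix b b' :: "'v \<Rightarrow> int" assume "\<And>S. S \<in> pivot V u v T \<C> \<Longrightarrow> sgn (sum b S) = sgn (sum b' S)"
    then have cmp: "sgn (sum b S - sum b T) = sgn (sum b' S - sum b' T)" if "S \<in> ch" for S
      using sgn_chain_diff[OF V fam uv(1,2) that[unfolded ch_def] T[unfolded ch_def]] by blast
    have "sgn (2 * sum b T + e) = sgn (2 * sum b' T + e)"
      using sgn_half_step[OF _ e, of "sum b T" "sum b' T"] cmp[OF u_ch(2)] by simp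
    moreover have "sgn (2 * (b u - sum b T) + - e) = sgn (2 * (b' u - sum b' T) + - e)"
      using sgn_half_step[of "b u - sum b T" "b' u - sum b' T" "- e"] cmp[OF u_ch(1)] e by auto
    moreover have "x \<le> y \<longleftrightarrow> sgn (y - x) \<noteq> -1" "0 < x \<longleftrightarrow> sgn x = 1" for x y :: int
      by (auto simp: sgn_if)
    ultimately show "(0 < 2 * sum b T + e \<and> 2 * sum b T + e \<le> 2 * b u) =
        (0 < 2 * sum b' T + e \<and> 2 * sum b' T + e \<le> 2 * b' u)"
      by (simp add: algebra_simps)
  qed
  have mult_det: "sign_determined V (pivot V u v T \<C>) (\<lambda>b. mult b T)" if T: "T \<in> ch" for T
    unfolding sign_determined_def
  proof (intro ballI impI)
    fix b b' :: "'v \<Rightarrow> int" assume "\<forall>S\<in>pivot V u v T \<C>. sgn (sum b S) = sgn (sum b' S)"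
    then have cmp: "sgn (sum b S - sum b T) = sgn (sum b' S - sum b' T)" if "S \<in> ch" for S
      using sgn_chain_diff[OF V fam uv(1,2) that[unfolded ch_def] T[unfolded ch_def]] by blast
    have "sum b S = sum b T \<longleftrightarrow> sum b' S = sum b' T" if "S \<in> ch" for S
      using cmp[OF that] by (auto simp: sgn_if split: if_splits)
    then show "mult b T = mult b' T" unfolding mult_def by (metis (mono_tags, lifting) Collect_cong)
  qed
  have coeff_det: "sign_determined V (pivot V u v T \<C>)
      (\<lambda>b. (\<eta> b (2 * sum b T + e) - \<eta> b (2 * sum b T + e')) / mult b T)"
    if "T \<in> ch" "e \<in> {-1, 0, 1}" "e' \<in> {-1, 0, 1}" for T e e'
    by (rule sign_determined_op2[OF sign_determined_op2[OF \<eta>_det[OF that(1,2)] \<eta>_det[OF that(1,3)],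
          where f = "(-)"] mult_det[OF that(1)], where f = "(/)"])
  have G_poly: "poly_on (zero_sum V) ?L (Suc (k + D)) (\<lambda>b. G (b, sum b T + e))" if "T \<in> ch" for T e
  proof (rule poly_on_subst[OF G])
    fix l assume "l \<in> coords_with_time ?L"
    then consider "l = (\<lambda>z. real_of_int (snd z))" | l' where "l' \<in> ?L" "l = (\<lambda>z. l' (fst z))" by blast
    then show "poly_on (zero_sum V) ?L (Suc 0) (\<lambda>b. l (b, sum b T + e))"
    proof cases
      case 1
      have "poly_on (zero_sum V) ?L (Suc 0) (\<lambda>b. real_of_int (sum b T) + real_of_int e)"
        by (intro poly_on.add poly_on.const poly_on_cut ch_V that)
      with 1 show ?thesis by simp
    qed (auto intro: poly_on_coord)
  qed auto
  have pieces: "cut_polynomial V \<D> (Suc (k + D)) (\<lambda>b. \<Sum>T\<in>ch.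
      (\<eta> b (2 * sum b T + -1) - \<eta> b (2 * sum b T + 0)) / mult b T * G (b, sum b T + 0) +
      (\<eta> b (2 * sum b T + 0) - \<eta> b (2 * sum b T + 1)) / mult b T * G (b, sum b T + 1))"
    by (intro cut_polynomial_sum cut_polynomial.add;
        rule cut_polynomial.piece[OF pivot_fam sub coeff_det G_poly]) (auto simp: ch_def)

  have "(\<Sum>t\<in>{1..b u}. real_of_int t ^ k * (\<kappa> (shift u v t b) * P (shift u v t b))) =
     (\<Sum>T\<in>ch.
      (\<eta> b (2 * sum b T + -1) - \<eta> b (2 * sum b T + 0)) / mult b T * G (b, sum b T + 0) +
      (\<eta> b (2 * sum b T + 0) - \<eta> b (2 * sum b T + 1)) / mult b T * G (b, sum b T + 1))"
    if b: "b \<in> zero_sum V" for b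
  proof -
    have zs: "shift u v s (\<lambda>w. 2 * b w) \<in> zero_sum V" for s
      using b by (intro shift_zero_sum V uv) (simp add: zero_sum_def sum_distrib_left[symmetric])
    have even: "\<kappa> (shift u v (2 * t) (\<lambda>w. 2 * b w)) = \<kappa> (shift u v t b)" for t
    proof -
      have "shift u v (2 * t) (\<lambda>w. 2 * b w) = (\<lambda>w. 2 * shift u v t b w)"
        by (auto simp: shift_def fun_eq_iff)
      then show ?thesis
        using sign_determined_double[OF \<kappa> shift_zero_sum[OF V uv(1,2) b]] by simp
    qed
    have step: "\<eta> b s = \<eta> b s'"
      if eq: "\<And>c. c \<in> sum b ` ch \<Longrightarrow> sgn (s - 2 * c) = sgn (s' - 2 * c)" for s s'
    proof -
      have cmp: "sgn (s - 2 * sum b S) = sgn (s' - 2 * sum b S)" if "S \<in> ch" for S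
        using eq that by blast
      have val: "sum (shift u v s (\<lambda>w. 2 * b w)) S = - (s - 2 * sum b S)"
        if "u \<in> S" "v \<notin> S" "S \<subseteq> V" for S s
        using that V finite_subset[OF that(3)] by (simp add: sum_shift sum_distrib_left[symmetric])
      have "sgn (sum (shift u v s (\<lambda>w. 2 * b w)) S) = sgn (sum (shift u v s' (\<lambda>w. 2 * b w)) S)"
        if S: "S \<in> \<C>" for S
      proof -
        have SV: "S \<subseteq> V" "finite S" using cut_familyD(2)[OF fam S] V by (auto intro: finite_subset)
        consider "\<not> separates u v S" | "u \<in> S" "v \<notin> S" | "u \<notin> S" "v \<in> S"
          by (auto simp: separates_def)
        then show ?thesis
        proof cases
          case 1
          then show ?thesis using SV by (auto simp: sum_shift separates_def)
        next
          case 2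
          then have "S \<in> ch" using S by (auto simp: ch_def cut_chain_def)
          from cmp[OF this] show ?thesis using val[OF 2 SV(1)] by (auto simp: sgn_if split: if_splits)
        next
          case 3
          then have "V - S \<in> ch"
            using S uv cut_familyD(3)[OF fam] by (auto simp: ch_def cut_chain_def)
          from cmp[OF this] val[of "V - S"] 3 uv
          have "sgn (sum (shift u v s (\<lambda>w. 2 * b w)) (V - S)) =
              sgn (sum (shift u v s' (\<lambda>w. 2 * b w)) (V - S))"
            by (auto simp: sgn_if split: if_splits)
          then show ?thesis
            using sum_compl_zero_sum[OF V zs SV(1)] by simp
        qed
      qed
      with \<kappa> zs have K: "\<kappa> (shift u v s (\<lambda>w. 2 * b w)) = \<kappa> (shift u v s' (\<lambda>w. 2 * b w))"
        unfolding sign_determined_def by blast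
      have Q: "(0 < s \<and> s \<le> 2 * b u) = (0 < s' \<and> s' \<le> 2 * b u)"
        using cmp[OF u_ch(1)] cmp[OF u_ch(2)] by (auto simp: sgn_if split: if_splits)
      show ?thesis unfolding \<eta>_def by (rule if_cong[OF Q K refl])
    qed
    have "(\<Sum>t\<in>{1..b u}. real_of_int t ^ k * (\<kappa> (shift u v t b) * P (shift u v t b))) =
        (\<Sum>t\<in>{1..b u}. (G (b, t + 1) - G (b, t)) * \<eta> b (2 * t))"
    proof (rule sum.cong)
      fix t assume t: "t \<in> {1..b u}"
      have "\<eta> b (2 * t) = \<kappa> (shift u v t b)" using t even[of t] by (simp add: \<eta>_def)
      moreover have "G (b, t + 1) - G (b, t) = real_of_int t ^ k * P (shift u v t b)"
        using pG[OF b, of t] by simp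
      ultimately show "real_of_int t ^ k * (\<kappa> (shift u v t b) * P (shift u v t b)) =
          (G (b, t + 1) - G (b, t)) * \<eta> b (2 * t)" by simp
    qed simp
    also have "\<dots> = (\<Sum>c\<in>sum b ` ch. G (b, c) * (\<eta> b (2 * c - 1) - \<eta> b (2 * c)) +
        G (b, c + 1) * (\<eta> b (2 * c) - \<eta> b (2 * c + 1)))"
    proof (rule sum_by_breakpoints[OF finite_imageI[OF fin_ch] step])
      show "\<eta> b s = 0" if "s \<le> 0 \<or> s > 2 * b u" for s
        using that unfolding \<eta>_def by (intro if_not_P) linarith
    qed
    also have "\<dots> = (\<Sum>T\<in>ch. (G (b, sum b T) * (\<eta> b (2 * sum b T - 1) - \<eta> b (2 * sum b T)) +
        G (b, sum b T + 1) * (\<eta> b (2 * sum b T) - \<eta> b (2 * sum b T + 1))) / mult b T)"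
      unfolding mult_def by (rule sum_image_weighted[OF fin_ch])
    finally show ?thesis by (simp add: add_divide_distrib mult.commute)
  qed
  then show ?case by (intro cut_polynomial.cong[OF pieces]) simp
qed

text \<open>
  An edge that joins two components \<open>A\<close> and \<open>B\<close> must carry the whole excess of \<open>A\<close>. Nothing is
  summed, so the degree grows by the exponent \<open>k\<close> only. Hence the number of summations that
  raise the degree is the first Betti number of the graph.
\<close>
lemma cut_polynomial_bridge:
  fixes V :: "'v set"
  assumes V: "finite V" and uv: "u \<in> V" "v \<in> V"
    and AB: "A \<in> \<D>" "B \<in> \<D>" "u \<in> A" "v \<in> B" "A \<inter> B = {}"
    and others: "\<And>C. C \<in> \<D> - {A, B} \<Longrightarrow> \<not> separates u v C"
    and F: "cut_polynomial V \<D> D F"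
  shows "cut_polynomial V (insert (A \<union> B) (\<D> - {A, B})) (k + D)
           (\<lambda>b. if sum b A > 0 then real_of_int (sum b A) ^ k * F (shift u v (sum b A) b) else 0)"
  using F
proof (induction rule: cut_polynomial.induct)
  case zero
  show ?case by (rule cut_polynomial.cong[OF cut_polynomial.zero]) simp
next
  case (add F H)
  show ?case
    by (rule cut_polynomial.cong[OF cut_polynomial.add[OF add.IH]]) (simp add: distrib_left)
next
  case (cong F H)
  show ?case
    by (rule cut_polynomial.cong[OF cong(3)]) (use cong(2) shift_zero_sum[OF V uv] in auto)
next
  case (piece \<C> \<kappa> P)
  have A: "A \<in> \<C>" "A \<subseteq> V" and B: "B \<in> \<C>" "B \<subseteq> V"
    using AB piece(2) cut_familyD(2)[OF piece(1)] by auto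
  then have A_ch: "A \<in> cut_chain u v \<C>" using AB by (auto simp: cut_chain_def)
  let ?\<C>' = "pivot V u v A \<C>"
  have fam: "cut_family V ?\<C>'" by (rule cut_family_pivot[OF piece(1) uv A_ch])
  have "V - (A \<union> B) \<in> ?\<C>'"
  proof -
    have "V - B \<in> \<C>" "separates u v (V - B)"
      using cut_familyD(3)[OF piece(1) B(1)] AB uv by (auto simp: separates_def)
    moreover have "V - (A \<union> B) = (V - B - A) \<union> (A - (V - B))" using AB(5) A(2) by auto
    ultimately show ?thesis unfolding pivot_def by force
  qed
  from cut_familyD(3)[OF fam this] have "A \<union> B \<in> ?\<C>'" using A B by (simp add: double_diff)
  then have sub: "insert (A \<union> B) (\<D> - {A, B}) \<subseteq> ?\<C>'"
    using subset_pivot[of "\<D> - {A, B}" \<C> u v V A] piece(2) others by blast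
  let ?\<kappa> = "\<lambda>b. if sum b A > 0 then \<kappa> (shift u v (2 * sum b A + 0) (\<lambda>w. 2 * b w)) else 0"
  have det: "sign_determined V ?\<C>' ?\<kappa>"
  proof (rule sign_determined_if)
    show "sign_determined V ?\<C>' (\<lambda>b. \<kappa> (shift u v (2 * sum b A + 0) (\<lambda>w. 2 * b w)))"
      by (rule sign_determined_pivot[OF V piece(1) uv A_ch piece(3)]) simp
    fix b b' :: "'v \<Rightarrow> int" assume "\<And>S. S \<in> ?\<C>' \<Longrightarrow> sgn (sum b S) = sgn (sum b' S)"
    then have "sgn (sum b A) = sgn (sum b' A)" by (auto simp: pivot_def)
    then show "(0 < sum b A) = (0 < sum b' A)" by (auto simp: sgn_if split: if_splits)
  qed
  have "poly_on (zero_sum V) (vertex_coords V) (k * Suc 0 + D)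
      (\<lambda>b. real_of_int (sum b A) ^ k * P (shift u v (sum b A) b))"
  proof (intro poly_on_mult poly_on_power poly_on_cut A(2))
    show "poly_on (zero_sum V) (vertex_coords V) D (\<lambda>b. P (shift u v (sum b A) b))"
    proof (rule poly_on_subst[OF piece(4)])
      fix l assume "l \<in> vertex_coords V"
      then obtain w where w: "w \<in> V" "l = (\<lambda>b. real_of_int (b w))" by (auto simp: vertex_coords_def)
      from poly_on.add[OF poly_on_vertex[OF w(1)]
          poly_on_cmult[OF poly_on_cut[OF A(2)], of _ "(if w = v then 1 else 0) - (if w = u then 1 else 0)"]]
      show "poly_on (zero_sum V) (vertex_coords V) (Suc 0) (\<lambda>b. l (shift u v (sum b A) b))"
        by (rule poly_on.cong) (auto simp: w(2) shift_def)
    qed (use V uv in \<open>auto intro: shift_zero_sum\<close>)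
  qed
  then have "cut_polynomial V (insert (A \<union> B) (\<D> - {A, B})) (k + D)
      (\<lambda>b. ?\<kappa> b * (real_of_int (sum b A) ^ k * P (shift u v (sum b A) b)))"
    by (intro cut_polynomial.piece[OF fam sub det]) simp
  then show ?case
  proof (rule cut_polynomial.cong)
    fix b assume b: "b \<in> zero_sum V"
    have "shift u v (2 * sum b A) (\<lambda>w. 2 * b w) = (\<lambda>w. 2 * shift u v (sum b A) b w)"
      by (auto simp: shift_def fun_eq_iff)
    with sign_determined_double[OF piece(3) shift_zero_sum[OF V uv b]]
    show "?\<kappa> b * (real_of_int (sum b A) ^ k * P (shift u v (sum b A) b)) =
      (if sum b A > 0 then real_of_int (sum b A) ^ k *
        (\<kappa> (shift u v (sum b A) b) * P (shift u v (sum b A) b)) else 0)" by simp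
  qed
qed

section \<open>Sums over positive flows on a graph\<close>

text \<open>Flows vanish off \<open>E\<close>, so that each is one function and restriction to fewer edges is an update.\<close>
definition flows ::
  "'v set \<Rightarrow> ('e \<Rightarrow> 'v) \<Rightarrow> ('e \<Rightarrow> 'v) \<Rightarrow> 'e set \<Rightarrow> ('v \<Rightarrow> int) \<Rightarrow> ('e \<Rightarrow> nat) set" where
  "flows V src tgt E b = {w. (\<forall>e. e \<in> E \<longleftrightarrow> 0 < w e) \<and>
     (\<forall>v\<in>V. b v + (\<Sum>e | e \<in> E \<and> tgt e = v. int (w e)) = (\<Sum>e | e \<in> E \<and> src e = v. int (w e)))}"

definition flow_sum ::
  "'v set \<Rightarrow> ('e \<Rightarrow> 'v) \<Rightarrow> ('e \<Rightarrow> 'v) \<Rightarrow> 'e set \<Rightarrow> ('e \<Rightarrow> nat) \<Rightarrow> ('v \<Rightarrow> int) \<Rightarrow> real" where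
  "flow_sum V src tgt E k b = (\<Sum>w\<in>flows V src tgt E b. \<Prod>e\<in>E. real (w e) ^ k e)"

lemma flows_empty: "flows V src tgt {} b = (if \<forall>v\<in>V. b v = 0 then {\<lambda>_. 0} else {})"
  by (auto simp: flows_def fun_eq_iff)

lemma flow_sum_nonzeroD: "flow_sum V src tgt E k b \<noteq> 0 \<Longrightarrow> \<exists>w. w \<in> flows V src tgt E b"
  by (cases "flows V src tgt E b = {}") (auto simp: flow_sum_def)

lemma sum_fibre_insert:
  fixes w :: "'e \<Rightarrow> nat" and h :: "'e \<Rightarrow> 'v"
  assumes "finite E" "e \<notin> E"
  shows "(\<Sum>e' | e' \<in> insert e E \<and> h e' = x. int (w e')) =
    (if x = h e then int (w e) else 0) + (\<Sum>e' | e' \<in> E \<and> h e' = x. int ((w(e := 0)) e'))"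
proof -
  have eq: "(\<Sum>e' | e' \<in> E \<and> h e' = x. int ((w(e := 0)) e')) = (\<Sum>e' | e' \<in> E \<and> h e' = x. int (w e'))"
    using assms(2) by (intro sum.cong) auto
  show ?thesis
  proof (cases "h e = x")
    case True
    then have "{e'. e' \<in> insert e E \<and> h e' = x} = insert e {e'. e' \<in> E \<and> h e' = x}" by auto
    then show ?thesis using True assms eq by simp
  next
    case False
    then have "{e'. e' \<in> insert e E \<and> h e' = x} = {e'. e' \<in> E \<and> h e' = x}" by auto
    then show ?thesis using False eq by simp
  qed
qed

lemma flows_insert:
  assumes "finite E" "e \<notin> E"
  shows "w \<in> flows V src tgt (insert e E) b \<longleftrightarrow>
    0 < w e \<and> w(e := 0) \<in> flows V src tgt E (shift (src e) (tgt e) (int (w e)) b)"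
proof -
  have "(\<forall>e'. e' \<in> insert e E \<longleftrightarrow> 0 < w e') \<longleftrightarrow> 0 < w e \<and> (\<forall>e'. e' \<in> E \<longleftrightarrow> 0 < (w(e := 0)) e')"
    using assms(2) by (auto simp: fun_upd_def)
  moreover have "(b x + (\<Sum>e' | e' \<in> insert e E \<and> tgt e' = x. int (w e')) =
      (\<Sum>e' | e' \<in> insert e E \<and> src e' = x. int (w e'))) \<longleftrightarrow>
    (shift (src e) (tgt e) (int (w e)) b x + (\<Sum>e' | e' \<in> E \<and> tgt e' = x. int ((w(e := 0)) e')) =
      (\<Sum>e' | e' \<in> E \<and> src e' = x. int ((w(e := 0)) e')))" for x
    unfolding sum_fibre_insert[OF assms, where h = tgt] sum_fibre_insert[OF assms, where h = src] shift_def by arith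
  ultimately show ?thesis unfolding flows_def by auto
qed

lemma flow_restrict_bij:
  assumes "finite E" "e \<notin> E"
    and bound: "\<And>w. w \<in> flows V src tgt (insert e E) b \<Longrightarrow> int (w e) \<le> N"
  shows "bij_betw (\<lambda>(t, w). w(e := nat t))
    (SIGMA t:{1..N}. flows V src tgt E (shift (src e) (tgt e) t b)) (flows V src tgt (insert e E) b)"
proof (rule bij_betwI[where g = "\<lambda>w. (int (w e), w(e := 0))"])
  have z: "w e = 0" if "w \<in> flows V src tgt E b'" for w b'
    using that assms(2) by (auto simp: flows_def)
  show "(\<lambda>(t, w). w(e := nat t)) \<in> (SIGMA t:{1..N}. flows V src tgt E (shift (src e) (tgt e) t b)) \<rightarrow>
      flows V src tgt (insert e E) b"
  proof safe
    fix t w assume t: "t \<in> {1..N}" and w: "w \<in> flows V src tgt E (shift (src e) (tgt e) t b)"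
    have "w(e := 0) = w" using z[OF w] by auto
    then show "w(e := nat t) \<in> flows V src tgt (insert e E) b"
      using t w by (simp add: flows_insert[OF assms(1,2)])
  qed
  show "(\<lambda>w. (int (w e), w(e := 0))) \<in> flows V src tgt (insert e E) b \<rightarrow>
      (SIGMA t:{1..N}. flows V src tgt E (shift (src e) (tgt e) t b))"
    using bound by (auto simp: flows_insert[OF assms(1,2)])
  show "(\<lambda>w. (int (w e), w(e := 0))) ((\<lambda>(t, w). w(e := nat t)) p) = p"
    if "p \<in> (SIGMA t:{1..N}. flows V src tgt E (shift (src e) (tgt e) t b))" for p
    using that z by (auto simp: fun_eq_iff)
  show "(\<lambda>(t, w). w(e := nat t)) ((\<lambda>w. (int (w e), w(e := 0))) w) = w" for w
    by (auto simp: fun_eq_iff)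
qed

text \<open>
  No edge enters a vertex that is the least tail, so the excess of that vertex bounds the weights of
  the edges leaving it. Removing edges in the order of their tails keeps all sums finite.
\<close>
lemma weight_le_excess:
  fixes src tgt :: "'e \<Rightarrow> nat"
  assumes fin: "finite E" and mono: "\<And>e'. e' \<in> insert e E \<Longrightarrow> src e' < tgt e'"
    and least: "\<And>e'. e' \<in> E \<Longrightarrow> src e \<le> src e'" and V: "src e \<in> V"
    and w: "w \<in> flows V src tgt (insert e E) b"
  shows "int (w e) \<le> b (src e)"
proof -
  have "tgt e' \<noteq> src e" if "e' \<in> insert e E" for e'
    using mono[OF that] least[of e'] that by auto
  then have no_in: "{e'. e' \<in> insert e E \<and> tgt e' = src e} = {}" by blast
  have "b (src e) + (\<Sum>e' | e' \<in> insert e E \<and> tgt e' = src e. int (w e')) =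
      (\<Sum>e' | e' \<in> insert e E \<and> src e' = src e. int (w e'))"
    using w V unfolding flows_def by blast
  then have "b (src e) = (\<Sum>e' | e' \<in> insert e E \<and> src e' = src e. int (w e'))"
    unfolding no_in by simp
  also have "\<dots> \<ge> int (w e)"
    using fin by (intro member_le_sum[of e _ "\<lambda>e'. int (w e')"]) auto
  finally show ?thesis .
qed

lemma finite_flows:
  fixes src tgt :: "'e \<Rightarrow> nat"
  assumes "finite E" "\<And>e. e \<in> E \<Longrightarrow> src e \<in> V \<and> src e < tgt e"
  shows "finite (flows V src tgt E b)"
  using assms
proof (induction E arbitrary: b rule: finite_ranking_induct[where f = "\<lambda>e. - int (src e)"])
  case empty
  then show ?case by (simp add: flows_empty)
next
  case (insert e E)
  show ?case
  proof (cases "e \<in> E")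
    case True
    then show ?thesis using insert by (simp add: insert_absorb)
  next
    case False
    have "bij_betw (\<lambda>(t, w). w(e := nat t))
      (SIGMA t:{1..b (src e)}. flows V src tgt E (shift (src e) (tgt e) t b)) (flows V src tgt (insert e E) b)"
      by (rule flow_restrict_bij[OF insert(1) False], rule weight_le_excess[OF insert(1)])
        (use insert(2,4) in auto)
    moreover have "finite (SIGMA t:{1..b (src e)}. flows V src tgt E (shift (src e) (tgt e) t b))"
      using insert by (intro finite_SigmaI) auto
    ultimately show ?thesis by (metis bij_betw_finite)
  qed
qed

lemma flow_sum_insert:
  fixes src tgt :: "'e \<Rightarrow> nat"
  assumes fin: "finite E" and e: "e \<notin> E"
    and E: "\<And>e'. e' \<in> insert e E \<Longrightarrow> src e' \<in> V \<and> src e' < tgt e'"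
    and least: "\<And>e'. e' \<in> E \<Longrightarrow> src e \<le> src e'"
  shows "flow_sum V src tgt (insert e E) k b =
    (\<Sum>t\<in>{1..b (src e)}. real_of_int t ^ k e * flow_sum V src tgt E k (shift (src e) (tgt e) t b))"
proof -
  let ?fl = "\<lambda>t. flows V src tgt E (shift (src e) (tgt e) t b)"
  have bij: "bij_betw (\<lambda>(t, w). w(e := nat t)) (SIGMA t:{1..b (src e)}. ?fl t)
      (flows V src tgt (insert e E) b)"
    by (rule flow_restrict_bij[OF fin e], rule weight_le_excess[OF fin]) (use E least in auto)
  have "flow_sum V src tgt (insert e E) k b =
      (\<Sum>(t, w)\<in>(SIGMA t:{1..b (src e)}. ?fl t). \<Prod>e'\<in>insert e E. real ((w(e := nat t)) e') ^ k e')"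
    unfolding flow_sum_def by (subst sum.reindex_bij_betw[OF bij, symmetric]) (simp add: case_prod_unfold)
  also have "\<dots> = (\<Sum>t\<in>{1..b (src e)}. \<Sum>w\<in>?fl t. \<Prod>e'\<in>insert e E. real ((w(e := nat t)) e') ^ k e')"
    by (subst sum.Sigma) (use fin E in \<open>auto intro!: finite_flows\<close>)
  also have "\<dots> = (\<Sum>t\<in>{1..b (src e)}. real_of_int t ^ k e * flow_sum V src tgt E k (shift (src e) (tgt e) t b))"
  proof (rule sum.cong)
    fix t assume t: "t \<in> {1..b (src e)}"
    have "(\<Prod>e'\<in>insert e E. real ((w(e := nat t)) e') ^ k e') =
        real_of_int t ^ k e * (\<Prod>e'\<in>E. real (w e') ^ k e')" for w
    proof -
      have "(\<Prod>e'\<in>E. real ((w(e := nat t)) e') ^ k e') = (\<Prod>e'\<in>E. real (w e') ^ k e')"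
        using e by (intro prod.cong) auto
      then show ?thesis using t fin e by (simp add: of_nat_nat)
    qed
    then show "(\<Sum>w\<in>?fl t. \<Prod>e'\<in>insert e E. real ((w(e := nat t)) e') ^ k e') =
        real_of_int t ^ k e * flow_sum V src tgt E k (shift (src e) (tgt e) t b)"
      by (simp add: flow_sum_def sum_distrib_left)
  qed simp
  finally show ?thesis .
qed

lemma flows_closed_set:
  fixes src tgt :: "'e \<Rightarrow> 'v"
  assumes fin: "finite E" "finite A" and A: "A \<subseteq> V" and closed: "\<And>e. e \<in> E \<Longrightarrow> \<not> separates (src e) (tgt e) A"
    and w: "w \<in> flows V src tgt E b"
  shows "sum b A = 0"
proof -
  have group: "(\<Sum>v\<in>A. \<Sum>e | e \<in> E \<and> h e = v. int (w e)) = (\<Sum>e | e \<in> E \<and> h e \<in> A. int (w e))"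
    for h :: "'e \<Rightarrow> 'v"
  proof -
    have "(\<Sum>v\<in>A. \<Sum>e | e \<in> {e \<in> E. h e \<in> A} \<and> h e = v. int (w e)) = (\<Sum>e | e \<in> E \<and> h e \<in> A. int (w e))"
      by (rule sum.group) (use fin in auto)
    moreover have "{e. e \<in> {e \<in> E. h e \<in> A} \<and> h e = v} = {e. e \<in> E \<and> h e = v}" if "v \<in> A" for v
      using that by auto
    ultimately show ?thesis by simp
  qed
  have "(\<Sum>v\<in>A. b v + (\<Sum>e | e \<in> E \<and> tgt e = v. int (w e))) = (\<Sum>v\<in>A. \<Sum>e | e \<in> E \<and> src e = v. int (w e))"
    using w A by (intro sum.cong) (auto simp: flows_def)
  then have "sum b A + (\<Sum>e | e \<in> E \<and> tgt e \<in> A. int (w e)) = (\<Sum>e | e \<in> E \<and> src e \<in> A. int (w e))"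
    by (simp add: sum.distrib group)
  moreover have "{e. e \<in> E \<and> tgt e \<in> A} = {e. e \<in> E \<and> src e \<in> A}"
    using closed by (auto simp: separates_def)
  ultimately show ?thesis by simp
qed

lemma cut_family_singletons: "finite V \<Longrightarrow> cut_family V ((\<lambda>v. {v}) ` V \<union> (\<lambda>v. V - {v}) ` V)"
  unfolding cut_family_def cross_free_def by (auto simp: double_diff)

lemma cut_polynomial_no_edges:
  assumes "finite V"
  shows "cut_polynomial V ((\<lambda>v. {v}) ` V) 0 (flow_sum V src tgt {} k)"
proof -
  let ?\<C> = "(\<lambda>v. {v}) ` V \<union> (\<lambda>v. V - {v}) ` V"
  have "sign_determined V ?\<C> (\<lambda>b. if \<forall>v\<in>V. b v = 0 then 1 else 0)"
    unfolding sign_determined_def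
  proof (intro ballI impI)
    fix b b' :: "'a \<Rightarrow> int" assume *: "\<forall>S\<in>?\<C>. sgn (sum b S) = sgn (sum b' S)"
    have "sgn (b v) = sgn (b' v)" if "v \<in> V" for v
    proof -
      have "sgn (sum b {v}) = sgn (sum b' {v})" using * that by blast
      then show ?thesis by simp
    qed
    then have "(\<forall>v\<in>V. b v = 0) \<longleftrightarrow> (\<forall>v\<in>V. b' v = 0)" by (metis sgn_0_0)
    then show "(if \<forall>v\<in>V. b v = 0 then 1 else 0) = (if \<forall>v\<in>V. b' v = 0 then 1 else (0 :: real))" by simp
  qed
  from cut_polynomial.piece[OF cut_family_singletons[OF assms] _ this poly_on.const[of _ _ 0 1]]
  show ?thesis
    by (rule cut_polynomial.cong) (auto simp: flow_sum_def flows_empty)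
qed

lemma partition_on_merge:
  assumes "partition_on V \<D>" "A \<in> \<D>" "B \<in> \<D>" "A \<noteq> B"
  shows "partition_on V (insert (A \<union> B) (\<D> - {A, B}))"
proof -
  have disj: "X \<inter> Z = {}" if "X \<in> \<D>" "Z \<in> \<D>" "X \<noteq> Z" for X Z
    using assms(1) that by (auto simp: partition_on_def dest: disjointD)
  have "\<Union>(insert (A \<union> B) (\<D> - {A, B})) = \<Union>\<D>" using assms(2,3) by auto
  moreover have "disjoint (insert (A \<union> B) (\<D> - {A, B}))"
  proof (rule disjointI)
    fix X Z assume "X \<in> insert (A \<union> B) (\<D> - {A, B})" "Z \<in> insert (A \<union> B) (\<D> - {A, B})" "X \<noteq> Z"
    then consider "X = A \<union> B" "Z \<in> \<D>" "Z \<noteq> A" "Z \<noteq> B"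
      | "Z = A \<union> B" "X \<in> \<D>" "X \<noteq> A" "X \<noteq> B" | "X \<in> \<D>" "Z \<in> \<D>" by blast
    then show "X \<inter> Z = {}"
    proof cases
      case 1
      then show ?thesis using disj[of A Z] disj[of B Z] assms(2,3) by (simp add: Int_Un_distrib2)
    next
      case 2
      then show ?thesis using disj[of X A] disj[of X B] assms(2,3) by (simp add: Int_Un_distrib)
    qed (rule disj[OF _ _ \<open>X \<noteq> Z\<close>])
  qed
  moreover have "{} \<notin> insert (A \<union> B) (\<D> - {A, B})"
    using assms(1,2) by (auto simp: partition_on_def)
  ultimately show ?thesis using assms(1) by (simp add: partition_on_def)
qed

lemma card_merge:
  assumes "partition_on V \<D>" "finite V" "A \<in> \<D>" "B \<in> \<D>" "A \<noteq> B"
  shows "Suc (card (insert (A \<union> B) (\<D> - {A, B}))) = card \<D>"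
proof -
  have fin: "finite \<D>" using finite_elements assms(1,2) by blast
  have "A \<union> B \<notin> \<D> - {A, B}"
  proof
    assume *: "A \<union> B \<in> \<D> - {A, B}"
    have "disjoint \<D>" using assms(1) by (simp add: partition_on_def)
    moreover have "A \<union> B \<in> \<D>" "A \<noteq> A \<union> B" using * by auto
    ultimately have "disjnt A (A \<union> B)" using assms(3) by (meson pairwiseD)
    then have "A = {}" by (auto simp: disjnt_def)
    then show False using assms(1,3) by (simp add: partition_on_def)
  qed
  moreover have "card (\<D> - {A, B}) = card \<D> - 2" "card \<D> \<ge> 2"
    using fin assms card_Diff_subset[of "{A, B}" \<D>] card_mono[of \<D> "{A, B}"] by auto
  ultimately show ?thesis using fin by simp
qed

lemma flow_sum_cut_polynomial:
  fixes src tgt :: "'e \<Rightarrow> nat"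
  assumes "finite E" and V: "finite V"
    and "\<And>e. e \<in> E \<Longrightarrow> src e \<in> V \<and> tgt e \<in> V \<and> src e < tgt e"
  shows "\<exists>\<D> D. partition_on V \<D> \<and> (\<forall>e\<in>E. \<forall>A\<in>\<D>. \<not> separates (src e) (tgt e) A) \<and>
     D + card V = sum k E + card E + card \<D> \<and> cut_polynomial V \<D> D (flow_sum V src tgt E k)"
  using assms(1,3)
proof (induction E rule: finite_ranking_induct[where f = "\<lambda>e. - int (src e)"])
  case empty
  have "partition_on V ((\<lambda>v. {v}) ` V)" by (auto simp: partition_on_def disjoint_def)
  moreover have "card ((\<lambda>v. {v}) ` V) = card V" by (simp add: card_image)
  ultimately show ?case using cut_polynomial_no_edges[OF V] by fastforce
next
  case (insert e E)
  show ?case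
  proof (cases "e \<in> E")
    case True
    then show ?thesis using insert by (simp add: insert_absorb)
  next
    case False
    define u v where "u = src e" and "v = tgt e"
    have uv: "u \<in> V" "v \<in> V" "u \<noteq> v" using insert(4)[of e] by (auto simp: u_def v_def)
    from insert obtain \<D> D where part: "partition_on V \<D>"
      and closed: "\<And>e A. e \<in> E \<Longrightarrow> A \<in> \<D> \<Longrightarrow> \<not> separates (src e) (tgt e) A"
      and D: "D + card V = sum k E + card E + card \<D>"
      and poly: "cut_polynomial V \<D> D (flow_sum V src tgt E k)" by blast
    have rec: "flow_sum V src tgt (insert e E) k b =
        (\<Sum>t\<in>{1..b u}. real_of_int t ^ k e * flow_sum V src tgt E k (shift u v t b))" for b
      unfolding u_def v_def by (rule flow_sum_insert[OF insert(1) False]) (use insert in auto)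
    obtain A where A: "A \<in> \<D>" "u \<in> A" using part uv by (auto simp: partition_on_def)
    obtain B where B: "B \<in> \<D>" "v \<in> B" using part uv by (auto simp: partition_on_def)
    have block: "C = A" if "C \<in> \<D>" "u \<in> C" for C
      using that A part by (auto simp: partition_on_def disjoint_def)
    have block': "C = B" if "C \<in> \<D>" "v \<in> C" for C
      using that B part by (auto simp: partition_on_def disjoint_def)
    show ?thesis
    proof (cases "A = B")
      case True
      have nonsep: "\<not> separates u v C" if "C \<in> \<D>" for C
        using that block block' True A B unfolding separates_def by blast
      have "cut_polynomial V \<D> (Suc (k e + D)) (flow_sum V src tgt (insert e E) k)"
        by (rule cut_polynomial.cong[OF cut_polynomial_edge_sum[OF V uv nonsep poly]])
          (simp_all add: rec)
      moreover have "Suc (k e + D) + card V = sum k (insert e E) + card (insert e E) + card \<D>"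
        using D insert(1) False by simp
      moreover have "\<forall>e'\<in>insert e E. \<forall>A\<in>\<D>. \<not> separates (src e') (tgt e') A"
        using closed nonsep by (auto simp: u_def v_def)
      ultimately show ?thesis using part by blast
    next
      case False
      let ?\<D>' = "insert (A \<union> B) (\<D> - {A, B})"
      have "disjoint \<D>" using part by (simp add: partition_on_def)
      then have disj: "A \<inter> B = {}" using A(1) B(1) False by (rule disjointD)
      have AV: "A \<subseteq> V" "finite A" using part A V by (auto simp: partition_on_def intro: finite_subset)
      have others: "\<not> separates u v C" if "C \<in> \<D> - {A, B}" for C
        using that block block' by (auto simp: separates_def)
      have bridge: "flow_sum V src tgt (insert e E) k b =
          (if sum b A > 0 then real_of_int (sum b A) ^ k e * flow_sum V src tgt E k (shift u v (sum b A) b)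
           else 0)" for b
      proof -
        have only: "t = sum b A" if "flow_sum V src tgt E k (shift u v t b) \<noteq> 0" for t
        proof -
          from that obtain w where "w \<in> flows V src tgt E (shift u v t b)"
            by (auto dest: flow_sum_nonzeroD)
          from flows_closed_set[OF insert(1) AV(2,1) closed this] A(1)
          have "sum (shift u v t b) A = 0" by blast
          moreover have "v \<notin> A" using B(2) disj by auto
          ultimately show ?thesis using AV(2) A(2) by (simp add: sum_shift)
        qed
        have bound: "sum b A \<le> b u"
          if nz: "flow_sum V src tgt E k (shift u v (sum b A) b) \<noteq> 0" and pos: "sum b A > 0"
        proof -
          from nz obtain w where w: "w \<in> flows V src tgt E (shift u v (sum b A) b)"
            by (auto dest: flow_sum_nonzeroD)
          then have "w(e := 0) = w" using \<open>e \<notin> E\<close> by (auto simp: flows_def)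
          with w pos have "w(e := nat (sum b A)) \<in> flows V src tgt (insert e E) b"
            by (simp add: flows_insert[OF insert(1) \<open>e \<notin> E\<close>] u_def v_def)
          from weight_le_excess[OF insert(1) _ _ _ this] insert(2,4) pos show ?thesis
            by (force simp: u_def)
        qed
        have "flow_sum V src tgt (insert e E) k b = (\<Sum>t\<in>{1..b u}. if t = sum b A
          then real_of_int t ^ k e * flow_sum V src tgt E k (shift u v t b) else 0)"
          unfolding rec by (intro sum.cong) (use only in auto)
        also have "\<dots> = (if sum b A \<in> {1..b u}
          then real_of_int (sum b A) ^ k e * flow_sum V src tgt E k (shift u v (sum b A) b) else 0)"
          by simp
        finally show ?thesis using bound by auto
      qed
      have "cut_polynomial V ?\<D>' (k e + D) (flow_sum V src tgt (insert e E) k)"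
        by (rule cut_polynomial.cong[OF cut_polynomial_bridge
              [OF V uv(1,2) A(1) B(1) A(2) B(2) disj others poly]]) (simp_all add: bridge)
      moreover have "k e + D + card V = sum k (insert e E) + card (insert e E) + card ?\<D>'"
        using D card_merge[OF part V A(1) B(1) False] insert(1) \<open>e \<notin> E\<close> by simp
      moreover have "\<forall>e'\<in>insert e E. \<forall>C\<in>?\<D>'. \<not> separates (src e') (tgt e') C"
      proof (intro ballI)
        fix e' C assume e': "e' \<in> insert e E" and "C \<in> ?\<D>'"
        then consider "C = A \<union> B" | "C \<in> \<D> - {A, B}" by blast
        then show "\<not> separates (src e') (tgt e') C"
        proof cases
          case 1
          show ?thesis
          proof (cases "e' = e")
            case True
            then show ?thesis using 1 A(2) B(2) by (simp add: separates_def u_def v_def)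
          next
            case False
            with e' have "e' \<in> E" by simp
            then show ?thesis
              using closed[OF _ A(1)] closed[OF _ B(1)] 1 by (simp add: separates_def)
          qed
        next
          case 2
          then show ?thesis using e' others[OF 2] closed[of e' C] by (auto simp: u_def v_def)
        qed
      qed
      ultimately show ?thesis using partition_on_merge[OF part A(1) B(1) False] by blast
    qed
  qed
qed

text \<open>Where no cut changes its sign, the coefficients \<open>\<kappa>\<close> are constants.\<close>
lemma cut_polynomial_on_cell:
  assumes F: "cut_polynomial V \<D> D F"
    and zs: "\<And>y. y \<in> Y \<Longrightarrow> \<beta> y \<in> zero_sum V"
    and lin: "\<And>v. v \<in> V \<Longrightarrow> poly_on Y L (Suc 0) (\<lambda>y. real_of_int (\<beta> y v))"
    and cell: "\<And>y y' S. y \<in> Y \<Longrightarrow> y' \<in> Y \<Longrightarrow> S \<subseteq> V \<Longrightarrow> sgn (sum (\<beta> y) S) = sgn (sum (\<beta> y') S)"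
  shows "poly_on Y L D (\<lambda>y. F (\<beta> y))"
  using F
proof (induction rule: cut_polynomial.induct)
  case (piece \<C> \<kappa> P)
  have P: "poly_on Y L D (\<lambda>y. P (\<beta> y))"
    by (rule poly_on_subst[OF piece(4)]) (use zs lin in \<open>auto simp: vertex_coords_def\<close>)
  show ?case
  proof (cases "Y = {}")
    case True
    then show ?thesis by (intro poly_on.cong[OF P]) auto
  next
    case False
    then obtain y0 where y0: "y0 \<in> Y" by blast
    have "\<kappa> (\<beta> y) = \<kappa> (\<beta> y0)" if y: "y \<in> Y" for y
    proof -
      have "\<forall>S\<in>\<C>. sgn (sum (\<beta> y) S) = sgn (sum (\<beta> y0) S)"
        using cell[OF y y0] cut_familyD(2)[OF piece(1)] by blast
      then show ?thesis using piece(3) zs[OF y] zs[OF y0] unfolding sign_determined_def by blast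
    qed
    then show ?thesis
      by (intro poly_on.cong[OF poly_on_cmult[OF P, of "\<kappa> (\<beta> y0)"]]) simp
  qed
next
  case (cong F H)
  then show ?case using zs by (auto intro: poly_on.cong)
qed (auto intro: poly_on.intros)

text \<open>
  A polynomial in the weights is a sum of monomials; multiplying by one weight raises one
  exponent. The induction carries an arbitrary monomial along.
\<close>
lemma poly_on_flow_sum:
  assumes "finite E"
    and mono: "\<And>k. poly_on Y L (sum k E + r) (\<lambda>x. flow_sum V src tgt E k (\<beta> x))"
    and f: "poly_on (Y \<times> UNIV)
        ((\<lambda>l z. l (fst z)) ` L \<union> (\<lambda>e z. real (snd z e)) ` E) d f"
  shows "poly_on Y L (d + sum k E + r)
    (\<lambda>x. \<Sum>w\<in>flows V src tgt E (\<beta> x). f (x, w) * (\<Prod>e\<in>E. real (w e) ^ k e))"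
  using f
proof (induction arbitrary: k rule: poly_on.induct)
  case (const d c)
  have "poly_on Y L (d + sum k E + r) (\<lambda>x. c * flow_sum V src tgt E k (\<beta> x))"
    by (rule poly_on_mono[OF poly_on_cmult[OF mono]]) simp
  then show ?case by (simp add: flow_sum_def sum_distrib_left)
next
  case (add d f h)
  from poly_on.add[OF add.IH] show ?case by (simp add: distrib_right sum.distrib)
next
  case (coord l d f)
  then consider l' where "l' \<in> L" "l = (\<lambda>z. l' (fst z))" | e where "e \<in> E" "l = (\<lambda>z. real (snd z e))"
    by blast
  then show ?case
  proof cases
    case 1
    from poly_on.coord[OF 1(1) coord.IH[of k]] show ?thesis
      by (simp add: 1(2) sum_distrib_left mult.assoc)
  next
    case 2
    have "(\<Prod>e'\<in>E. real (w e') ^ (k(e := Suc (k e))) e') = real (w e) * (\<Prod>e'\<in>E. real (w e') ^ k e')" for w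
    proof -
      have "(\<Prod>e'\<in>E. real (w e') ^ (k(e := Suc (k e))) e') =
          (\<Prod>e'\<in>E. (if e' = e then real (w e) else 1) * real (w e') ^ k e')"
        by (intro prod.cong) auto
      then show ?thesis using \<open>finite E\<close> 2(1) by (simp add: prod.distrib)
    qed
    moreover have "sum (k(e := Suc (k e))) E = Suc (sum k E)"
    proof -
      have "sum (k(e := Suc (k e))) E = (\<Sum>e'\<in>E. (if e' = e then 1 else 0) + k e')"
        by (intro sum.cong) auto
      then show ?thesis using \<open>finite E\<close> 2(1) by (simp add: sum.distrib)
    qed
    ultimately show ?thesis
      using coord.IH[of "k(e := Suc (k e))"] by (simp add: 2(2) mult.assoc mult.left_commute)
  qed
next
  case (cong d f h)
  show ?case by (rule poly_on.cong[OF cong.IH]) (use cong(2) in simp)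
qed

section \<open>Chambers and polynomials in several variables\<close>

lemma sgn_sum_chamber:
  fixes C :: "(real ^ 'n::finite) set"
  assumes C: "C \<in> resonance_chambers" and y: "y \<in> C" "y' \<in> C"
  shows "sgn (\<Sum>i\<in>I. vec_nth y i) = sgn (\<Sum>i\<in>I. vec_nth y' i)"
proof -
  have sub: "C \<subseteq> resonance_complement"
    using C in_components_subset unfolding resonance_chambers_def by blast
  show ?thesis
  proof (cases "I = {} \<or> I = UNIV")
    case True
    have "(\<Sum>i\<in>UNIV. vec_nth z i) = 0" if "z \<in> C" for z
      using subsetD[OF sub that] by (simp add: resonance_complement_def)
    with True y show ?thesis by auto
  next
    case False
    let ?f = "\<lambda>y :: real ^ 'n. \<Sum>i\<in>I. vec_nth y i"
    have "topological_space_class.connected (?f ` C)"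
      using C in_components_connected unfolding resonance_chambers_def
      by (intro connected_continuous_image continuous_intros) blast+
    moreover have "?f z \<noteq> 0" if "z \<in> C" for z
      using subsetD[OF sub that] False by (simp add: resonance_complement_def) blast
    then have "0 \<notin> ?f ` C" unfolding image_iff by metis
    ultimately have "\<not> (?f a \<le> 0 \<and> 0 \<le> ?f b)" if "a \<in> C" "b \<in> C" for a b
      using that unfolding connected_iff_interval by blast
    from this[OF y] this[OF y(2,1)] show ?thesis by (auto simp: sgn_if)
  qed
qed

lemma poly_eval_superset:
  assumes "finite K" "Poly_Mapping.keys P \<subseteq> K"
  shows "poly_eval P y =
    (\<Sum>m\<in>K. Poly_Mapping.lookup P m * (\<Prod>i\<in>UNIV. vec_nth y i ^ Poly_Mapping.lookup m i))"
  unfolding poly_eval_def using assms by (intro sum.mono_neutral_left) (auto simp: in_keys_iff)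

lemma poly_eval_add: "poly_eval (P + Q) y = poly_eval P y + poly_eval Q y"
proof -
  let ?K = "Poly_Mapping.keys P \<union> Poly_Mapping.keys Q"
  have "poly_eval (P + Q) y = (\<Sum>m\<in>?K. Poly_Mapping.lookup (P + Q) m *
      (\<Prod>i\<in>UNIV. vec_nth y i ^ Poly_Mapping.lookup m i))"
    by (rule poly_eval_superset) (use Poly_Mapping.keys_add[of P Q] in auto)
  then show ?thesis
    by (simp add: poly_eval_superset[of ?K P] poly_eval_superset[of ?K Q] lookup_add
        distrib_right sum.distrib)
qed

lemma poly_eval_0: "poly_eval 0 y = 0"
  by (simp add: poly_eval_def)

lemma poly_eval_sum: "poly_eval (\<Sum>i\<in>I. P i) y = (\<Sum>i\<in>I. poly_eval (P i) y)"
  by (induction I rule: infinite_finite_induct) (auto simp: poly_eval_add poly_eval_0)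

lemma poly_eval_single:
  "poly_eval (Poly_Mapping.single m c) y = c * (\<Prod>i\<in>UNIV. vec_nth y i ^ Poly_Mapping.lookup m i)"
  by (cases "c = 0") (auto simp: poly_eval_def)

lemma total_degree_le_add: "total_degree_le P d \<Longrightarrow> total_degree_le Q d \<Longrightarrow> total_degree_le (P + Q) d"
  unfolding total_degree_le_def using Poly_Mapping.keys_add[of P Q] by blast

lemma total_degree_le_sum: "(\<And>i. i \<in> I \<Longrightarrow> total_degree_le (P i) d) \<Longrightarrow> total_degree_le (\<Sum>i\<in>I. P i) d"
  by (induction I rule: infinite_finite_induct)
    (auto intro: total_degree_le_add simp: total_degree_le_def[of 0])

lemma poly_on_imp_poly_eval:
  fixes \<phi> :: "'a \<Rightarrow> real ^ 'n::finite"
  assumes "poly_on Y (range (\<lambda>i y. vec_nth (\<phi> y) i)) d f"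
  shows "\<exists>P. total_degree_le P (int d) \<and> (\<forall>y\<in>Y. f y = poly_eval P (\<phi> y))"
  using assms
proof (induction rule: poly_on.induct)
  case (const d c)
  show ?case
    by (intro exI[of _ "Poly_Mapping.single 0 c"]) (auto simp: poly_eval_single total_degree_le_def)
next
  case (add d f h)
  then obtain P Q where "total_degree_le P (int d)" "total_degree_le Q (int d)"
    "\<forall>y\<in>Y. f y = poly_eval P (\<phi> y)" "\<forall>y\<in>Y. h y = poly_eval Q (\<phi> y)" by blast
  then show ?case by (intro exI[of _ "P + Q"]) (auto simp: poly_eval_add total_degree_le_add)
next
  case (coord l d f)
  then obtain i P where l: "l = (\<lambda>y. vec_nth (\<phi> y) i)" and P: "total_degree_le P (int d)"
    "\<forall>y\<in>Y. f y = poly_eval P (\<phi> y)" by blast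
  let ?raise = "\<lambda>m. m + Poly_Mapping.single i (1 :: nat)"
  let ?Q = "\<Sum>m\<in>Poly_Mapping.keys P. Poly_Mapping.single (?raise m) (Poly_Mapping.lookup P m)"
  have lookup: "Poly_Mapping.lookup (?raise m) j = Poly_Mapping.lookup m j + (if j = i then 1 else 0)" for m j
    by (simp add: lookup_add lookup_single when_def)
  have "total_degree_le ?Q (int (Suc d))"
  proof (rule total_degree_le_sum)
    fix m assume m: "m \<in> Poly_Mapping.keys P"
    have "(\<Sum>j\<in>UNIV. Poly_Mapping.lookup (?raise m) j) = Suc (\<Sum>j\<in>UNIV. Poly_Mapping.lookup m j)"
      unfolding lookup by (simp add: sum.distrib)
    moreover have "int (\<Sum>j\<in>UNIV. Poly_Mapping.lookup m j) \<le> int d"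
      using P(1) m by (auto simp: total_degree_le_def)
    ultimately show "total_degree_le (Poly_Mapping.single (?raise m) (Poly_Mapping.lookup P m)) (int (Suc d))"
      by (auto simp: total_degree_le_def simp del: of_nat_sum split: if_splits)
  qed
  moreover have "poly_eval ?Q (\<phi> y) = l y * poly_eval P (\<phi> y)" for y
  proof -
    have "(\<Prod>j\<in>UNIV. vec_nth (\<phi> y) j ^ Poly_Mapping.lookup (?raise m) j) =
        vec_nth (\<phi> y) i * (\<Prod>j\<in>UNIV. vec_nth (\<phi> y) j ^ Poly_Mapping.lookup m j)" for m
    proof -
      have "vec_nth (\<phi> y) j ^ Poly_Mapping.lookup (?raise m) j =
        (if j = i then vec_nth (\<phi> y) i else 1) * vec_nth (\<phi> y) j ^ Poly_Mapping.lookup m j" for j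
        unfolding lookup by simp
      then show ?thesis by (simp add: prod.distrib)
    qed
    then have "poly_eval ?Q (\<phi> y) = (\<Sum>m\<in>Poly_Mapping.keys P. l y *
        (Poly_Mapping.lookup P m * (\<Prod>j\<in>UNIV. vec_nth (\<phi> y) j ^ Poly_Mapping.lookup m j)))"
      by (simp add: poly_eval_sum poly_eval_single l mult.left_commute)
    then show ?thesis by (simp add: poly_eval_def sum_distrib_left)
  qed
  ultimately show ?case using P(2) by (intro exI[of _ ?Q]) auto
next
  case (cong d f h)
  then show ?case by auto
qed

section \<open>The vertex multiplicity is polynomial in the weights\<close>

lemma fps_nth_S_series_0: "fps_nth S_series 0 = 1"
proof -
  have z0: "fps_nth zeta_series 0 = 0" and z1: "fps_nth zeta_series 1 = 1"
    by (simp_all add: zeta_series_def)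
  then have "zeta_series \<noteq> 0" by auto
  with z0 have "1 \<le> subdegree zeta_series" by (intro subdegree_geI) auto
  then have S: "S_series = fps_shift 1 zeta_series"
    unfolding S_series_def
    by (metis fps_shift_times_fps_X nonzero_mult_div_cancel_right fps_X_neq_zero)
  show ?thesis unfolding S using z1 by simp
qed

text \<open>The coefficient of \<open>z ^ r\<close> has degree \<open>r\<close>: this grading is stable under products.\<close>
definition graded_poly_on :: "'a set \<Rightarrow> ('a \<Rightarrow> real) set \<Rightarrow> ('a \<Rightarrow> real fps) \<Rightarrow> bool" where
  "graded_poly_on Y L \<Phi> \<longleftrightarrow> (\<forall>r. poly_on Y L r (\<lambda>y. fps_nth (\<Phi> y) r))"

lemma graded_poly_on_const: "graded_poly_on Y L (\<lambda>_. f)"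
  by (simp add: graded_poly_on_def poly_on.const)

lemma graded_poly_on_mult:
  assumes "graded_poly_on Y L \<Phi>" "graded_poly_on Y L \<Psi>"
  shows "graded_poly_on Y L (\<lambda>y. \<Phi> y * \<Psi> y)"
  unfolding graded_poly_on_def
proof
  fix r
  have "poly_on Y L (i + (r - i)) (\<lambda>y. fps_nth (\<Phi> y) i * fps_nth (\<Psi> y) (r - i))" for i
    by (rule poly_on_mult) (use assms in \<open>auto simp: graded_poly_on_def\<close>)
  then have "poly_on Y L r (\<lambda>y. fps_nth (\<Phi> y) i * fps_nth (\<Psi> y) (r - i))" if "i \<le> r" for i
    using that by (metis le_add_diff_inverse)
  then show "poly_on Y L r (\<lambda>y. fps_nth (\<Phi> y * \<Psi> y) r)"
    unfolding fps_mult_nth by (intro poly_on_sum) simp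
qed

lemma graded_poly_on_prod:
  assumes "\<And>j. j \<in> J \<Longrightarrow> graded_poly_on Y L (\<Phi> j)"
  shows "graded_poly_on Y L (\<lambda>y. \<Prod>j\<in>J. \<Phi> j y)"
  using assms by (induction J rule: infinite_finite_induct)
    (auto intro: graded_poly_on_mult graded_poly_on_const)

lemma graded_poly_on_compose_linear:
  assumes "poly_on Y L (Suc 0) c"
  shows "graded_poly_on Y L (\<lambda>y. f oo (fps_const (c y) * fps_X))"
  unfolding graded_poly_on_def fps_nth_compose_linear
proof
  fix r
  have "poly_on Y L (r * Suc 0 + 0) (\<lambda>y. c y ^ r * fps_nth f r)"
    by (intro poly_on_mult poly_on_power assms poly_on.const)
  then show "poly_on Y L r (\<lambda>y. c y ^ r * fps_nth f r)" by simp
qed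

lemma poly_on_vertex_mult:
  assumes "\<And>e. e \<in> A \<Longrightarrow> poly_on Y L (Suc 0) (\<lambda>y. real (c y e))"
    and "\<And>i. i \<in> B \<Longrightarrow> poly_on Y L (Suc 0) (\<lambda>y. real (c' y i))"
  shows "poly_on Y L (2 * k)
    (\<lambda>y. vertex_mult l k (image_mset (c y) (mset_set A) + image_mset (c' y) (mset_set B)))"
proof -
  let ?S = "\<lambda>y :: nat. S_series oo (fps_const (real y) * fps_X)"
  let ?\<Phi> = "\<lambda>y. (\<Prod>e\<in>A. ?S (c y e)) * (\<Prod>i\<in>B. ?S (c' y i)) * inverse S_series"
  have "graded_poly_on Y L ?\<Phi>"
    by (intro graded_poly_on_mult graded_poly_on_prod graded_poly_on_compose_linear
        graded_poly_on_const assms)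
  moreover have "(\<Prod>y\<in>#image_mset (c z) (mset_set A) + image_mset (c' z) (mset_set B). ?S y) / S_series = ?\<Phi> z" for z
    by (simp add: fps_divide_unit fps_nth_S_series_0 prod_unfold_prod_mset image_mset.compositionality comp_def)
  ultimately have coeff: "poly_on Y L (2 * g1) (\<lambda>z. fps_nth
      ((\<Prod>y\<in>#image_mset (c z) (mset_set A) + image_mset (c' z) (mset_set B). ?S y) / S_series) (2 * g1))" for g1
    by (simp add: graded_poly_on_def)
  show ?thesis
    unfolding vertex_mult_def case_prod_unfold
    by (intro poly_on_cmult poly_on_sum) (rule poly_on_mono[OF coeff], auto)
qed

section \<open>Counting covers by labelled graphs\<close>

definition code_graph :: "nat \<Rightarrow> (nat \<times> nat) list \<Rightarrow> (nat, nat) pre_digraph" where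
  "code_graph l G =
     \<lparr>verts = {..<l}, arcs = {..<length G}, tail = (\<lambda>j. fst (G ! j)), head = (\<lambda>j. snd (G ! j))\<rparr>"

text \<open>
  A cover together with an enumeration of its arcs is a list of pairs of end points, the weights
  indexed by positions in this list, and the genera. Lengths are determined by the other data. The
  functions are \<open>0\<close> where their values do not matter, so that there are finitely many codes.
\<close>
definition coded_cover ::
  "(nat \<Rightarrow> real) \<Rightarrow> nat \<Rightarrow> (nat \<times> nat) list \<Rightarrow> ('n \<Rightarrow> nat) \<Rightarrow> (nat \<Rightarrow> nat) \<Rightarrow> (nat \<Rightarrow> nat) \<Rightarrow> 'n cover" where
  "coded_cover p l G a \<gamma> w =
     \<lparr>skel = code_graph l G, wt = w,
      len = (\<lambda>j. (p (snd (G ! j)) - p (fst (G ! j))) / real (w j)),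
      att = a, vgen = \<gamma>\<rparr>"

definition codes ::
  "(nat \<Rightarrow> real) \<Rightarrow> nat \<Rightarrow> int ^ 'n::finite \<Rightarrow> nat list \<Rightarrow>
     (((nat \<times> nat) list \<times> ('n \<Rightarrow> nat) \<times> (nat \<Rightarrow> nat)) \<times> (nat \<Rightarrow> nat)) set" where
  "codes p g x ls = {((G, a, \<gamma>), w). (\<forall>v\<ge>length ls. \<gamma> v = 0) \<and> (\<forall>j\<ge>length G. w j = 0) \<and>
     coded_cover p (length ls) G a \<gamma> w \<in> covers p g x ls}"

definition encode ::
  "nat \<Rightarrow> 'n cover \<Rightarrow> nat list \<Rightarrow> ((nat \<times> nat) list \<times> ('n \<Rightarrow> nat) \<times> (nat \<Rightarrow> nat)) \<times> (nat \<Rightarrow> nat)" where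
  "encode l \<pi> es = ((map (\<lambda>e. (tail (skel \<pi>) e, head (skel \<pi>) e)) es, att \<pi>,
      (\<lambda>v. if v < l then vgen \<pi> v else 0)), (\<lambda>j. if j < length es then wt \<pi> (es ! j) else 0))"

definition decode where
  "decode p l c = (case c of ((G, a, \<gamma>), w) \<Rightarrow> coded_cover p l G a \<gamma> w)"

lemma code_graph_simps [simp]:
  "verts (code_graph l G) = {..<l}" "arcs (code_graph l G) = {..<length G}"
  "tail (code_graph l G) = (\<lambda>j. fst (G ! j))" "head (code_graph l G) = (\<lambda>j. snd (G ! j))"
  by (simp_all add: code_graph_def)

lemma coded_cover_simps [simp]:
  "skel (coded_cover p l G a \<gamma> w) = code_graph l G"
  "wt (coded_cover p l G a \<gamma> w) = w"
  "len (coded_cover p l G a \<gamma> w) = (\<lambda>j. (p (snd (G ! j)) - p (fst (G ! j))) / real (w j))"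
  "att (coded_cover p l G a \<gamma> w) = a"
  "vgen (coded_cover p l G a \<gamma> w) = \<gamma>"
  by (simp_all add: coded_cover_def)

lemma covers_arcD:
  assumes "\<pi> \<in> covers p g x ls" "e \<in> arcs (skel \<pi>)"
  shows "wt \<pi> e > 0 \<and> len \<pi> e > 0 \<and>
    p (head (skel \<pi>) e) - p (tail (skel \<pi>) e) = real (wt \<pi> e) * len \<pi> e"
proof -
  have "\<forall>e\<in>arcs (skel \<pi>). wt \<pi> e > 0 \<and> len \<pi> e > 0 \<and>
      p (head (skel \<pi>) e) - p (tail (skel \<pi>) e) = real (wt \<pi> e) * len \<pi> e"
    using assms(1) unfolding covers_def by (elim CollectE conjE) assumption
  then show ?thesis using assms(2) by (rule bspec)
qed

lemma cover_iso_bij: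
  assumes "cover_iso f \<pi> \<pi>'"
  shows "bij_betw f (in_arcs (skel \<pi>) v) (in_arcs (skel \<pi>') v)"
    and "bij_betw f (out_arcs (skel \<pi>) v) (out_arcs (skel \<pi>') v)"
    and "bij_betw f (in_arcs (skel \<pi>) v \<union> out_arcs (skel \<pi>) v)
      (in_arcs (skel \<pi>') v \<union> out_arcs (skel \<pi>') v)"
proof -
  have bij: "bij_betw f (arcs (skel \<pi>)) (arcs (skel \<pi>'))"
    and th: "\<And>e. e \<in> arcs (skel \<pi>) \<Longrightarrow> tail (skel \<pi>') (f e) = tail (skel \<pi>) e \<and>
        head (skel \<pi>') (f e) = head (skel \<pi>) e"
    using assms by (auto simp: cover_iso_def)
  have sub: "bij_betw f {e \<in> arcs (skel \<pi>). P e} {e \<in> arcs (skel \<pi>'). P' e}"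
    if "\<And>e. e \<in> arcs (skel \<pi>) \<Longrightarrow> P' (f e) = P e" for P P'
    by (rule bij_betw_Collect[OF bij]) (rule that)
  show "bij_betw f (in_arcs (skel \<pi>) v) (in_arcs (skel \<pi>') v)"
    unfolding in_arcs_def by (rule sub) (simp add: th)
  show "bij_betw f (out_arcs (skel \<pi>) v) (out_arcs (skel \<pi>') v)"
    unfolding out_arcs_def by (rule sub) (simp add: th)
  have "in_arcs G v \<union> out_arcs G v = {e \<in> arcs G. head G e = v \<or> tail G e = v}"
    for G :: "(nat, nat) pre_digraph" by (auto simp: in_arcs_def out_arcs_def)
  then show "bij_betw f (in_arcs (skel \<pi>) v \<union> out_arcs (skel \<pi>) v)
      (in_arcs (skel \<pi>') v \<union> out_arcs (skel \<pi>') v)"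
    by (simp only:) (rule sub, simp add: th)
qed

lemma cover_iso_adjacent_weights:
  assumes "cover_iso f \<pi> \<pi>'"
  shows "adjacent_weights x \<pi>' v = adjacent_weights x \<pi> v"
proof -
  let ?A = "in_arcs (skel \<pi>) v \<union> out_arcs (skel \<pi>) v"
  let ?A' = "in_arcs (skel \<pi>') v \<union> out_arcs (skel \<pi>') v"
  have bij: "bij_betw f ?A ?A'" by (rule cover_iso_bij(3)[OF assms])
  have "image_mset (wt \<pi>') (mset_set ?A') = image_mset (wt \<pi>') (image_mset f (mset_set ?A))"
    using bij by (subst image_mset_mset_set) (auto simp: bij_betw_def)
  also have "\<dots> = image_mset (wt \<pi>' \<circ> f) (mset_set ?A)" by (simp add: image_mset.compositionality)
  also have "\<dots> = image_mset (wt \<pi>) (mset_set ?A)"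
  proof (rule image_mset_cong)
    fix e assume "e \<in># mset_set ?A"
    then have "e \<in> arcs (skel \<pi>)"
      by (cases "finite ?A") auto
    then show "(wt \<pi>' \<circ> f) e = wt \<pi> e" using assms by (simp add: cover_iso_def)
  qed
  finally show ?thesis using assms by (simp add: adjacent_weights_def cover_iso_def)
qed

lemma cover_iso_balanced:
  assumes "cover_iso f \<pi> \<pi>'"
  shows "balanced x \<pi>' v = balanced x \<pi> v"
proof -
  have wt: "int (wt \<pi>' (f e)) = int (wt \<pi> e)" if "e \<in> arcs (skel \<pi>)" for e
    using that assms by (simp add: cover_iso_def)
  have "(\<Sum>e\<in>in_arcs (skel \<pi>') v. int (wt \<pi>' e)) = (\<Sum>e\<in>in_arcs (skel \<pi>) v. int (wt \<pi>' (f e)))"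
    by (rule sum.reindex_bij_betw[OF cover_iso_bij(1)[OF assms], symmetric])
  also have "\<dots> = (\<Sum>e\<in>in_arcs (skel \<pi>) v. int (wt \<pi> e))"
    by (rule sum.cong) (auto simp: wt)
  finally have i: "(\<Sum>e\<in>in_arcs (skel \<pi>') v. int (wt \<pi>' e)) = (\<Sum>e\<in>in_arcs (skel \<pi>) v. int (wt \<pi> e))" .
  have "(\<Sum>e\<in>out_arcs (skel \<pi>') v. int (wt \<pi>' e)) = (\<Sum>e\<in>out_arcs (skel \<pi>) v. int (wt \<pi>' (f e)))"
    by (rule sum.reindex_bij_betw[OF cover_iso_bij(2)[OF assms], symmetric])
  also have "\<dots> = (\<Sum>e\<in>out_arcs (skel \<pi>) v. int (wt \<pi> e))"
    by (rule sum.cong) (auto simp: wt)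
  finally have o: "(\<Sum>e\<in>out_arcs (skel \<pi>') v. int (wt \<pi>' e)) = (\<Sum>e\<in>out_arcs (skel \<pi>) v. int (wt \<pi> e))" .
  show ?thesis using assms unfolding balanced_def i o by (simp add: cover_iso_def)
qed

lemma covers_closed_under_iso:
  assumes iso: "cover_iso f \<pi> \<pi>'" and \<pi>': "\<pi>' \<in> covers p g x ls" and wf: "wf_digraph (skel \<pi>)"
  shows "\<pi> \<in> covers p g x ls"
proof -
  have V: "verts (skel \<pi>) = verts (skel \<pi>')" and bij: "bij_betw f (arcs (skel \<pi>)) (arcs (skel \<pi>'))"
    and vgen: "\<And>v. v \<in> verts (skel \<pi>) \<Longrightarrow> vgen \<pi>' v = vgen \<pi> v" and att: "att \<pi>' = att \<pi>"
    using iso by (auto simp: cover_iso_def)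
  have e: "tail (skel \<pi>') (f e) = tail (skel \<pi>) e" "head (skel \<pi>') (f e) = head (skel \<pi>) e"
    "wt \<pi>' (f e) = wt \<pi> e" "len \<pi>' (f e) = len \<pi> e" if "e \<in> arcs (skel \<pi>)" for e
    using iso that by (auto simp: cover_iso_def)
  have fin': "fin_digraph (skel \<pi>')" using \<pi>' by (simp add: covers_def)
  then have "finite (arcs (skel \<pi>'))" "finite (verts (skel \<pi>'))"
    by (auto intro: fin_digraph.finite_arcs fin_digraph.finite_verts)
  then have fin: "finite (arcs (skel \<pi>))" "finite (verts (skel \<pi>))"
    using bij V by (auto simp: bij_betw_finite)
  have "fin_digraph (skel \<pi>)"
    using wf fin by (simp add: fin_digraph_def fin_digraph_axioms_def)
  moreover have "mk_symmetric (skel \<pi>) = mk_symmetric (skel \<pi>')"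
  proof -
    have img: "arcs (skel \<pi>') = f ` arcs (skel \<pi>)" using bij by (auto simp: bij_betw_def)
    show ?thesis unfolding mk_symmetric_def V img using e by simp
  qed
  then have "Digraph_Component.connected (skel \<pi>)"
    using \<pi>' by (simp add: covers_def Digraph_Component.connected_def)
  moreover have "\<forall>e\<in>arcs (skel \<pi>). wt \<pi> e > 0 \<and> len \<pi> e > 0 \<and>
      p (head (skel \<pi>) e) - p (tail (skel \<pi>) e) = real (wt \<pi> e) * len \<pi> e"
  proof
    fix d assume d: "d \<in> arcs (skel \<pi>)"
    then have "f d \<in> arcs (skel \<pi>')" using bij by (auto simp: bij_betw_def)
    then have "wt \<pi>' (f d) > 0 \<and> len \<pi>' (f d) > 0 \<and>
      p (head (skel \<pi>') (f d)) - p (tail (skel \<pi>') (f d)) = real (wt \<pi>' (f d)) * len \<pi>' (f d)"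
      by (rule covers_arcD[OF \<pi>'])
    then show "wt \<pi> d > 0 \<and> len \<pi> d > 0 \<and>
      p (head (skel \<pi>) d) - p (tail (skel \<pi>) d) = real (wt \<pi> d) * len \<pi> d"
      unfolding e[OF d] .
  qed
  moreover have "betti (skel \<pi>) = betti (skel \<pi>')"
    using bij_betw_same_card[OF bij] V by (simp add: betti_def)
  moreover have "valency x \<pi>' v = valency x \<pi> v" for v
    by (simp add: valency_def cover_iso_adjacent_weights[OF iso])
  moreover have "(\<Sum>v\<in>verts (skel \<pi>'). int (vgen \<pi>' v)) = (\<Sum>v\<in>verts (skel \<pi>'). int (vgen \<pi> v))"
    using vgen V by simp
  ultimately show ?thesis
    using \<pi>' vgen unfolding covers_def mem_Collect_eq V att cover_iso_balanced[OF iso]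
    by (elim conjE) (intro conjI; simp)
qed

lemma encode_iso:
  assumes \<pi>: "\<pi> \<in> covers p g x ls" and es: "es \<in> permutations_of_set (arcs (skel \<pi>))"
  shows "cover_iso ((!) es) (decode p (length ls) (encode (length ls) \<pi> es)) \<pi>"
    and "encode (length ls) \<pi> es \<in> codes p g x ls"
proof -
  have es': "distinct es" "set es = arcs (skel \<pi>)"
    using es by (auto simp: permutations_of_set_def)
  have V: "verts (skel \<pi>) = {..<length ls}" and wf: "wf_digraph (skel \<pi>)"
    using \<pi> by (auto simp: covers_def fin_digraph_def)
  have bij: "bij_betw ((!) es) {..<length es} (arcs (skel \<pi>))"
    using es' by (intro bij_betw_nth) auto
  have arc: "wt \<pi> (es ! j) > 0 \<and>
      p (head (skel \<pi>) (es ! j)) - p (tail (skel \<pi>) (es ! j)) = real (wt \<pi> (es ! j)) * len \<pi> (es ! j)"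
    if "j < length es" for j
  proof -
    have "es ! j \<in> arcs (skel \<pi>)" using nth_mem[OF that] es'(2) by simp
    then show ?thesis using covers_arcD[OF \<pi>] by simp
  qed
  show iso: "cover_iso ((!) es) (decode p (length ls) (encode (length ls) \<pi> es)) \<pi>"
    using bij arc by (auto simp: cover_iso_def decode_def encode_def V)
  have "wf_digraph (skel (decode p (length ls) (encode (length ls) \<pi> es)))"
  proof
    fix j assume "j \<in> arcs (skel (decode p (length ls) (encode (length ls) \<pi> es)))"
    then have j: "j < length es" by (simp add: decode_def encode_def)
    then have "es ! j \<in> arcs (skel \<pi>)" using nth_mem[OF j] es'(2) by simp
    with wf j show "tail (skel (decode p (length ls) (encode (length ls) \<pi> es))) j \<in>
        verts (skel (decode p (length ls) (encode (length ls) \<pi> es)))"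
      "head (skel (decode p (length ls) (encode (length ls) \<pi> es))) j \<in>
        verts (skel (decode p (length ls) (encode (length ls) \<pi> es)))"
      by (auto simp: decode_def encode_def V[symmetric] dest: wf_digraph.tail_in_verts wf_digraph.head_in_verts)
  qed
  from covers_closed_under_iso[OF iso \<pi> this]
  show "encode (length ls) \<pi> es \<in> codes p g x ls"
    by (simp add: codes_def decode_def encode_def)
qed

lemma code_of_iso:
  assumes c: "c \<in> codes p g x ls" and iso: "cover_iso f (decode p (length ls) c) \<pi>"
  shows "\<exists>es\<in>permutations_of_set (arcs (skel \<pi>)). encode (length ls) \<pi> es = c"
proof -
  obtain G a \<gamma> w where c_def: "c = ((G, a, \<gamma>), w)" by (cases c) auto
  have supp: "\<forall>v\<ge>length ls. \<gamma> v = 0" "\<forall>j\<ge>length G. w j = 0"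
    using c by (auto simp: codes_def c_def)
  have bij: "bij_betw f {..<length G} (arcs (skel \<pi>))"
    and data: "\<And>j. j < length G \<Longrightarrow> tail (skel \<pi>) (f j) = fst (G ! j) \<and> head (skel \<pi>) (f j) = snd (G ! j) \<and>
      wt \<pi> (f j) = w j" "att \<pi> = a" "\<And>v. v < length ls \<Longrightarrow> vgen \<pi> v = \<gamma> v"
    using iso by (auto simp: cover_iso_def decode_def c_def)
  let ?es = "map f [0..<length G]"
  have "?es \<in> permutations_of_set (arcs (skel \<pi>))"
    using bij by (auto simp: permutations_of_set_def bij_betw_def distinct_map atLeast0LessThan)
  moreover have "map (\<lambda>e. (tail (skel \<pi>) e, head (skel \<pi>) e)) ?es = G"
    by (rule nth_equalityI) (auto simp: data)
  moreover have "(\<lambda>v. if v < length ls then vgen \<pi> v else 0) = \<gamma>"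
    "(\<lambda>j. if j < length ?es then wt \<pi> (?es ! j) else 0) = w"
    using supp data by (auto simp: fun_eq_iff)
  ultimately show ?thesis
    using data(2) unfolding encode_def c_def by blast
qed

text \<open>Two enumerations of the arcs give the same code exactly if they differ by an automorphism.\<close>
lemma card_enumerations_same_code:
  assumes \<pi>: "\<pi> \<in> covers p g x ls" and es0: "es0 \<in> permutations_of_set (arcs (skel \<pi>))"
  shows "card {es \<in> permutations_of_set (arcs (skel \<pi>)). encode (length ls) \<pi> es = encode (length ls) \<pi> es0} =
    card (Aut \<pi>)"
proof -
  let ?A = "arcs (skel \<pi>)" and ?m = "length es0"
  have es0': "distinct es0" "set es0 = ?A" using es0 by (auto simp: permutations_of_set_def)
  have len: "len \<pi> e = (p (head (skel \<pi>) e) - p (tail (skel \<pi>) e)) / real (wt \<pi> e)" if "e \<in> ?A" for e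
  proof -
    from covers_arcD[OF \<pi> that] show ?thesis by simp
  qed
  have "bij_betw (\<lambda>f. map f es0) (Aut \<pi>)
    {es \<in> permutations_of_set ?A. encode (length ls) \<pi> es = encode (length ls) \<pi> es0}"
    unfolding bij_betw_def
  proof (intro conjI equalityI subsetI)
    show "inj_on (\<lambda>f. map f es0) (Aut \<pi>)"
    proof (rule inj_onI)
      fix f f' assume f: "f \<in> Aut \<pi>" "f' \<in> Aut \<pi>" and eq: "map f es0 = map f' es0"
      show "f = f'"
      proof
        fix e
        show "f e = f' e"
        proof (cases "e \<in> ?A")
          case True
          then show ?thesis using eq es0' by auto
        next
          case False
          have "f permutes ?A" "f' permutes ?A" using f by (auto simp: Aut_def)
          then show ?thesis using False by (simp add: permutes_not_in)
        qed
      qed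
    qed
  next
    fix es assume "es \<in> (\<lambda>f. map f es0) ` Aut \<pi>"
    then obtain f where f: "f permutes ?A" "cover_iso f \<pi> \<pi>" and es: "es = map f es0"
      by (auto simp: Aut_def)
    have "inj_on f ?A" using f(1) by (rule permutes_inj_on)
    then have "es \<in> permutations_of_set ?A"
      using es0' permutes_image[OF f(1)] by (auto simp: permutations_of_set_def distinct_map es)
    moreover have "tail (skel \<pi>) (f e) = tail (skel \<pi>) e" "head (skel \<pi>) (f e) = head (skel \<pi>) e"
      "wt \<pi> (f e) = wt \<pi> e" if "e \<in> set es0" for e
      using f(2) that es0' by (auto simp: cover_iso_def)
    then have "encode (length ls) \<pi> es = encode (length ls) \<pi> es0"
      by (auto simp: encode_def es fun_eq_iff)
    ultimately show "es \<in> {es \<in> permutations_of_set ?A. encode (length ls) \<pi> es = encode (length ls) \<pi> es0}"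
      by simp
  next
    fix es assume "es \<in> {es \<in> permutations_of_set ?A. encode (length ls) \<pi> es = encode (length ls) \<pi> es0}"
    then have es: "distinct es" "set es = ?A" and enc: "encode (length ls) \<pi> es = encode (length ls) \<pi> es0"
      by (auto simp: permutations_of_set_def)
    have m: "length es = ?m" using es es0' by (metis distinct_card)
    have bij0: "bij_betw ((!) es0) {..<?m} ?A" and bij: "bij_betw ((!) es) {..<?m} ?A"
      using es es0' m by (auto intro!: bij_betw_nth)
    define idx where "idx = inv_into {..<?m} ((!) es0)"
    have bij_idx: "bij_betw idx ?A {..<?m}"
      unfolding idx_def by (rule bij_betw_inv_into[OF bij0])
    have idx: "idx (es0 ! j) = j" if "j < ?m" for j
      unfolding idx_def by (rule bij_betw_inv_into_left[OF bij0]) (use that in simp)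
    define f where "f = (\<lambda>e. if e \<in> ?A then es ! idx e else e)"
    have "bij_betw (\<lambda>e. es ! idx e) ?A ?A"
      using bij_betw_trans[OF bij_idx bij] by (simp add: comp_def)
    then have bij_f: "bij_betw f ?A ?A" by (simp add: f_def cong: bij_betw_cong)
    have perm: "f permutes ?A" using bij_f by (rule bij_imp_permutes) (simp add: f_def)
    have f_nth: "f (es0 ! j) = es ! j" if "j < ?m" for j
      using that idx es0' by (auto simp: f_def)
    have maps: "map (\<lambda>e. (tail (skel \<pi>) e, head (skel \<pi>) e)) es = map (\<lambda>e. (tail (skel \<pi>) e, head (skel \<pi>) e)) es0"
      and wts: "(\<lambda>j. if j < length es then wt \<pi> (es ! j) else 0) = (\<lambda>j. if j < length es0 then wt \<pi> (es0 ! j) else 0)"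
      using enc unfolding encode_def by blast+
    have "cover_iso f \<pi> \<pi>"
      unfolding cover_iso_def
    proof (intro conjI ballI bij_f refl)
      fix e assume e: "e \<in> ?A"
      then obtain j where j: "j < ?m" "e = es0 ! j" using es0'(2) by (metis in_set_conv_nth)
      have fe: "f e = es ! j" using f_nth j by simp
      have "f e \<in> ?A" using e bij_f by (auto simp: bij_betw_def)
      show t: "tail (skel \<pi>) (f e) = tail (skel \<pi>) e" and h: "head (skel \<pi>) (f e) = head (skel \<pi>) e"
        using arg_cong[OF maps, of "\<lambda>xs. xs ! j"] j(1) m f_nth[OF j(1)] unfolding j(2) by auto
      show w: "wt \<pi> (f e) = wt \<pi> e"
        using fun_cong[OF wts, of j] j(1) m f_nth[OF j(1)] unfolding j(2) by simp
      show "len \<pi> (f e) = len \<pi> e" using len[OF e] len[OF \<open>f e \<in> ?A\<close>] t h w by simp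
    qed
    with perm have "f \<in> Aut \<pi>" by (simp add: Aut_def)
    moreover have "es = map f es0" by (rule nth_equalityI) (use m f_nth in auto)
    ultimately show "es \<in> (\<lambda>f. map f es0) ` Aut \<pi>" by blast
  qed
  from bij_betw_same_card[OF this] show ?thesis by (rule sym)
qed

lemma card_codes_of_class:
  assumes \<pi>: "\<pi> \<in> covers p g x ls"
  shows "card {c \<in> codes p g x ls. (decode p (length ls) c, \<pi>) \<in> cover_rel p g x ls} * card (Aut \<pi>) =
    fact (card (arcs (skel \<pi>)))"
proof -
  let ?P = "permutations_of_set (arcs (skel \<pi>))"
  let ?enc = "encode (length ls) \<pi>"
  have fin: "finite (arcs (skel \<pi>))"
    using \<pi> by (auto simp: covers_def intro: fin_digraph.finite_arcs)
  have dec: "decode p (length ls) c \<in> covers p g x ls" if "c \<in> codes p g x ls" for c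
    using that by (auto simp: codes_def decode_def)
  have "{c \<in> codes p g x ls. (decode p (length ls) c, \<pi>) \<in> cover_rel p g x ls} = ?enc ` ?P"
  proof (intro equalityI subsetI)
    fix c assume "c \<in> {c \<in> codes p g x ls. (decode p (length ls) c, \<pi>) \<in> cover_rel p g x ls}"
    then obtain f where "c \<in> codes p g x ls" "cover_iso f (decode p (length ls) c) \<pi>"
      by (auto simp: cover_rel_def)
    from code_of_iso[OF this] show "c \<in> ?enc ` ?P" by (metis image_eqI)
  next
    fix c assume "c \<in> ?enc ` ?P"
    then obtain es where es: "es \<in> ?P" "c = ?enc es" by blast
    from encode_iso[OF \<pi> es(1)] es(2) have "c \<in> codes p g x ls"
      "cover_iso ((!) es) (decode p (length ls) c) \<pi>" by auto
    then show "c \<in> {c \<in> codes p g x ls. (decode p (length ls) c, \<pi>) \<in> cover_rel p g x ls}"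
      using dec \<pi> unfolding cover_rel_def by blast
  qed
  moreover have "card ?P = card (?enc ` ?P) * card (Aut \<pi>)"
  proof -
    have "card ?P = (\<Sum>es\<in>?P. 1)" by simp
    also have "\<dots> = (\<Sum>c\<in>?enc ` ?P. \<Sum>es | es \<in> ?P \<and> ?enc es = c. 1)"
      by (rule sum.image_gen) simp
    also have "\<dots> = (\<Sum>c\<in>?enc ` ?P. card (Aut \<pi>))"
      using card_enumerations_same_code[OF \<pi>] by (intro sum.cong) auto
    finally show ?thesis by simp
  qed
  ultimately show ?thesis using fin by simp
qed

text \<open>
  Orbit counting: the enumerations of the arcs of a cover with \<open>m\<close> bounded edges are spread evenly
  over its codes, \<open>|Aut|\<close> to each. A sum over classes weighted by \<open>1 / |Aut|\<close> is
  thus a sum over codes weighted by \<open>1 / m!\<close>.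
\<close>
lemma sum_classes_eq_sum_codes:
  assumes fin: "finite (codes p g x ls)"
    and W: "\<And>f \<pi> \<pi>'. \<pi> \<in> covers p g x ls \<Longrightarrow> \<pi>' \<in> covers p g x ls \<Longrightarrow> cover_iso f \<pi> \<pi>' \<Longrightarrow> W \<pi> = W \<pi>'"
  shows "(\<Sum>K\<in>covers p g x ls // cover_rel p g x ls.
      1 / real (card (Aut (SOME \<pi>. \<pi> \<in> K))) * W (SOME \<pi>. \<pi> \<in> K)) =
    (\<Sum>c\<in>codes p g x ls. W (decode p (length ls) c) / fact (length (fst (fst c))))"
proof -
  let ?C = "covers p g x ls" and ?R = "cover_rel p g x ls" and ?d = "decode p (length ls)"
  let ?cl = "\<lambda>c. ?R `` {?d c}"
  have eqv: "equiv ?C ?R" by (rule equiv_cover_rel)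
  have dec: "?d c \<in> ?C" if "c \<in> codes p g x ls" for c
    using that by (auto simp: codes_def decode_def)
  have rep: "(SOME \<pi>. \<pi> \<in> K) \<in> ?C \<and> K = ?R `` {SOME \<pi>. \<pi> \<in> K}" if K: "K \<in> ?C // ?R" for K
  proof -
    have "(SOME \<pi>. \<pi> \<in> K) \<in> K"
      using in_quotient_imp_non_empty[OF eqv K] by (simp add: some_in_eq)
    moreover obtain \<pi> where "\<pi> \<in> ?C" and \<pi>: "K = ?R `` {\<pi>}" using K by (rule quotientE)
    ultimately have rel: "(\<pi>, SOME \<pi>. \<pi> \<in> K) \<in> ?R" by blast
    then have "(SOME \<pi>. \<pi> \<in> K) \<in> ?C" by (simp add: cover_rel_def)
    moreover have "K = ?R `` {SOME \<pi>. \<pi> \<in> K}"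
      using equiv_class_eq[OF eqv rel] \<pi> by (rule trans[rotated])
    ultimately show ?thesis ..
  qed
  have fibre: "{c \<in> codes p g x ls. ?cl c = K} = {c \<in> codes p g x ls. (?d c, SOME \<pi>. \<pi> \<in> K) \<in> ?R}"
    if "K \<in> ?C // ?R" for K
    using rep[OF that] eq_equiv_class_iff[OF eqv dec] by (metis (lifting))
  have fin_classes: "finite (?C // ?R)"
  proof (rule finite_surj[OF fin, of _ ?cl], rule subsetI)
    fix K assume K: "K \<in> ?C // ?R"
    have "{c \<in> codes p g x ls. ?cl c = K} \<noteq> {}"
    proof
      assume empty: "{c \<in> codes p g x ls. ?cl c = K} = {}"
      from card_codes_of_class[OF conjunct1[OF rep[OF K]]]
      have "fact (card (arcs (skel (SOME \<pi>. \<pi> \<in> K)))) = (0 :: nat)"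
        unfolding fibre[OF K, symmetric] empty by simp
      then show False by simp
    qed
    then show "K \<in> ?cl ` codes p g x ls" by auto
  qed
  have "(\<Sum>c\<in>codes p g x ls. W (?d c) / fact (length (fst (fst c)))) =
     (\<Sum>K\<in>?C // ?R. \<Sum>c | c \<in> codes p g x ls \<and> ?cl c = K. W (?d c) / fact (length (fst (fst c))))"
    by (rule sum.group[symmetric]) (use fin fin_classes dec in \<open>auto intro: quotientI\<close>)
  also have "\<dots> = (\<Sum>K\<in>?C // ?R. 1 / real (card (Aut (SOME \<pi>. \<pi> \<in> K))) * W (SOME \<pi>. \<pi> \<in> K))"
  proof (rule sum.cong)
    fix K assume K: "K \<in> ?C // ?R"
    let ?r = "SOME \<pi>. \<pi> \<in> K"
    let ?F = "{c \<in> codes p g x ls. (?d c, ?r) \<in> ?R}"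
    let ?m = "card (arcs (skel ?r))"
    have "W (?d c) / fact (length (fst (fst c))) = W ?r / fact ?m" if c: "c \<in> ?F" for c
    proof -
      from c obtain f where "?d c \<in> ?C" "?r \<in> ?C" and f: "cover_iso f (?d c) ?r"
        by (auto simp: cover_rel_def)
      then have "W (?d c) = W ?r" by (rule W)
      moreover have "length (fst (fst c)) = ?m"
        using f by (cases c) (auto simp: cover_iso_def decode_def dest!: bij_betw_same_card)
      ultimately show ?thesis by simp
    qed
    then have "(\<Sum>c\<in>?F. W (?d c) / fact (length (fst (fst c)))) = real (card ?F) * (W ?r / fact ?m)"
      by simp
    also have "\<dots> = 1 / real (card (Aut ?r)) * W ?r"
    proof -
      have n: "card ?F * card (Aut ?r) = fact ?m"
        by (rule card_codes_of_class) (use rep[OF K] in blast)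
      have "card (Aut ?r) \<noteq> 0"
      proof
        assume "card (Aut ?r) = 0"
        with n have "fact ?m = (0 :: nat)" by simp
        then show False by simp
      qed
      moreover have "real (card ?F * card (Aut ?r)) = fact ?m" unfolding n by simp
      then have "real (card ?F) * real (card (Aut ?r)) = fact ?m" by simp
      ultimately show ?thesis by (simp add: field_simps)
    qed
    finally show "(\<Sum>c | c \<in> codes p g x ls \<and> ?cl c = K. W (?d c) / fact (length (fst (fst c)))) =
        1 / real (card (Aut ?r)) * W ?r"
      using fibre[OF K] by simp
  qed simp
  finally show ?thesis by simp
qed

section \<open>Combinatorial types of covers\<close>

text \<open>The net weight flowing into a vertex from its ends.\<close>
definition excess :: "int ^ 'n::finite \<Rightarrow> ('n \<Rightarrow> nat) \<Rightarrow> nat \<Rightarrow> int" where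
  "excess x a v = (\<Sum>i | a i = v. vec_nth x i)"

definition type_valency :: "nat \<Rightarrow> (nat \<times> nat) list \<Rightarrow> ('n::finite \<Rightarrow> nat) \<Rightarrow> nat \<Rightarrow> nat" where
  "type_valency l G a v =
     card (in_arcs (code_graph l G) v \<union> out_arcs (code_graph l G) v) + card {i. a i = v}"

text \<open>The conditions on a code that involve neither \<open>x\<close> nor the weights.\<close>
definition cover_types ::
  "nat \<Rightarrow> nat list \<Rightarrow> ((nat \<times> nat) list \<times> ('n::finite \<Rightarrow> nat) \<times> (nat \<Rightarrow> nat)) set" where
  "cover_types g ls = {(G, a, \<gamma>).
     (\<forall>j<length G. fst (G ! j) < snd (G ! j) \<and> snd (G ! j) < length ls) \<and>
     Digraph_Component.connected (code_graph (length ls) G) \<and>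
     (\<forall>i. a i < length ls) \<and> (\<forall>v\<ge>length ls. \<gamma> v = 0) \<and>
     (\<forall>v<length ls. int (ls ! v) = int (type_valency (length ls) G a v) + 2 * int (\<gamma> v) - 2) \<and>
     int (length G) - int (length ls) + 1 + (\<Sum>v<length ls. int (\<gamma> v)) = int g}"

abbreviation type_flows ::
  "int ^ 'n::finite \<Rightarrow> nat \<Rightarrow> (nat \<times> nat) list \<Rightarrow> ('n \<Rightarrow> nat) \<Rightarrow> (nat \<Rightarrow> nat) set" where
  "type_flows x l G a \<equiv>
     flows {..<l} (\<lambda>j. fst (G ! j)) (\<lambda>j. snd (G ! j)) {..<length G} (excess x a)"

lemma valency_coded_cover: "valency x (coded_cover p l G a \<gamma> w) v = type_valency l G a v"
  by (simp add: valency_def adjacent_weights_def type_valency_def)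

lemma balanced_coded_cover:
  "balanced x (coded_cover p l G a \<gamma> w) v \<longleftrightarrow>
    excess x a v + (\<Sum>j | j \<in> {..<length G} \<and> snd (G ! j) = v. int (w j)) =
    (\<Sum>j | j \<in> {..<length G} \<and> fst (G ! j) = v. int (w j))"
proof -
  have "excess x a v = (\<Sum>i | a i = v. (if vec_nth x i > 0 then vec_nth x i else 0) -
      (if vec_nth x i < 0 then - vec_nth x i else 0))"
    unfolding excess_def by (intro sum.cong) auto
  also have "\<dots> = (\<Sum>i | a i = v \<and> vec_nth x i > 0. vec_nth x i) -
      (\<Sum>i | a i = v \<and> vec_nth x i < 0. - vec_nth x i)"
    by (simp only: sum_subtractf sum.inter_filter[symmetric, OF finite] mem_Collect_eq)
  finally show ?thesis unfolding balanced_def by (auto simp: in_arcs_def out_arcs_def)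
qed

lemma codes_eq:
  fixes x :: "int ^ 'n::finite"
  assumes p: "strict_mono_on {..<length ls} p"
  shows "codes p g x ls =
    (SIGMA t:cover_types g ls. case t of (G, a, \<gamma>) \<Rightarrow> type_flows x (length ls) G a)"
proof -
  let ?l = "length ls"
  have "((G, a, \<gamma>), w) \<in> codes p g x ls \<longleftrightarrow>
      (G, a, \<gamma>) \<in> cover_types g ls \<and> w \<in> type_flows x ?l G a"
    for G and a :: "'n \<Rightarrow> nat" and \<gamma> w
  proof -
    let ?D = "code_graph ?l G"
    let ?edges = "\<forall>j<length G. fst (G ! j) < snd (G ! j) \<and> snd (G ! j) < ?l"
    let ?len = "\<lambda>j. (p (snd (G ! j)) - p (fst (G ! j))) / real (w j)"
    let ?metric = "\<forall>j\<in>{..<length G}. w j > 0 \<and> ?len j > 0 \<and>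
        p (snd (G ! j)) - p (fst (G ! j)) = real (w j) * ?len j"
    let ?att = "\<forall>i. a i \<in> {..<?l}"
    let ?val = "\<forall>v\<in>{..<?l}. int (ls ! v) = int (type_valency ?l G a v) + 2 * int (\<gamma> v) - 2"
    let ?bal = "\<forall>v\<in>{..<?l}. excess x a v + (\<Sum>j | j \<in> {..<length G} \<and> snd (G ! j) = v. int (w j)) =
        (\<Sum>j | j \<in> {..<length G} \<and> fst (G ! j) = v. int (w j))"
    let ?betti = "int (length G) - int ?l + 1 + (\<Sum>v<?l. int (\<gamma> v)) = int g"
    let ?conn = "Digraph_Component.connected ?D"
    have 1: "((G, a, \<gamma>), w) \<in> codes p g x ls \<longleftrightarrow> (\<forall>v\<ge>?l. \<gamma> v = 0) \<and> (\<forall>j\<ge>length G. w j = 0) \<and>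
        fin_digraph ?D \<and> ?conn \<and> ?metric \<and> ?att \<and> ?val \<and> ?bal \<and> ?betti"
      unfolding codes_def covers_def mem_Collect_eq case_prod_conv coded_cover_simps code_graph_simps
        valency_coded_cover balanced_coded_cover betti_def card_lessThan
      by (simp only: simp_thms)
    have 2: "(G, a, \<gamma>) \<in> cover_types g ls \<longleftrightarrow> ?edges \<and> ?conn \<and> ?att \<and> (\<forall>v\<ge>?l. \<gamma> v = 0) \<and> ?val \<and> ?betti"
      unfolding cover_types_def mem_Collect_eq case_prod_conv Ball_def lessThan_iff by (rule refl)
    have 3: "w \<in> type_flows x ?l G a \<longleftrightarrow> (\<forall>j. j \<in> {..<length G} \<longleftrightarrow> 0 < w j) \<and> ?bal"
      unfolding flows_def mem_Collect_eq by (rule refl)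
    have 4: "(\<forall>j. j \<in> {..<length G} \<longleftrightarrow> 0 < w j) \<longleftrightarrow> (\<forall>j\<ge>length G. w j = 0) \<and> (\<forall>j<length G. w j > 0)"
      by (metis lessThan_iff not_less not_less_zero neq0_conv)
    have 5: "fin_digraph ?D \<and> ?metric \<longleftrightarrow> ?edges \<and> (\<forall>j<length G. w j > 0)"
    proof -
      have "fin_digraph ?D \<longleftrightarrow> (\<forall>j<length G. fst (G ! j) < ?l \<and> snd (G ! j) < ?l)"
        unfolding fin_digraph_def fin_digraph_axioms_def wf_digraph_def by auto
      moreover have "w j > 0 \<and> ?len j > 0 \<and>
          p (snd (G ! j)) - p (fst (G ! j)) = real (w j) * ?len j \<longleftrightarrow> w j > 0 \<and> fst (G ! j) < snd (G ! j)"
        if "fst (G ! j) < ?l" "snd (G ! j) < ?l" for j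
        using strict_mono_on_less[OF p, of "fst (G ! j)" "snd (G ! j)"] that
        by (auto simp: zero_less_divide_iff)
      ultimately show ?thesis unfolding Ball_def lessThan_iff by (meson less_trans)
    qed
    have arrange: "(q1 \<and> q2 \<and> f \<and> c \<and> m \<and> q3 \<and> q4 \<and> q5 \<and> q6) \<longleftrightarrow>
        (e \<and> c \<and> q3 \<and> q1 \<and> q4 \<and> q6) \<and> (q2 \<and> pos) \<and> q5"
      if "f \<and> m \<longleftrightarrow> e \<and> pos" for q1 q2 q3 q4 q5 q6 c f m e pos
      using that by blast
    show ?thesis unfolding 1 2 3 4 by (rule arrange[OF 5])
  qed
  then show ?thesis by auto
qed

lemma finite_cover_types: "finite (cover_types g ls :: (_ \<times> ('n::finite \<Rightarrow> nat) \<times> _) set)"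
proof -
  let ?l = "length ls"
  let ?N = "g + ?l"
  have "cover_types g ls \<subseteq> {G. set G \<subseteq> {..<?l} \<times> {..<?l} \<and> length G \<le> ?N} \<times>
      {a :: 'n \<Rightarrow> nat. \<forall>i. (i \<in> UNIV \<longrightarrow> a i \<in> {..<?l}) \<and> (i \<notin> UNIV \<longrightarrow> a i = 0)} \<times>
      {\<gamma>. \<forall>v. (v \<in> {..<?l} \<longrightarrow> \<gamma> v \<in> {..?N}) \<and> (v \<notin> {..<?l} \<longrightarrow> \<gamma> v = 0)}"
  proof (rule subrelI, goal_cases)
    case (1 G t)
    obtain a \<gamma> where t: "t = (a, \<gamma>)" by (cases t)
    have *: "\<forall>j<length G. fst (G ! j) < snd (G ! j) \<and> snd (G ! j) < ?l" "\<forall>i. a i < ?l" "\<forall>v\<ge>?l. \<gamma> v = 0"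
      "int (length G) - int ?l + 1 + (\<Sum>v<?l. int (\<gamma> v)) = int g"
      using 1 unfolding t cover_types_def by simp_all
    have "set G \<subseteq> {..<?l} \<times> {..<?l}"
    proof
      fix e assume "e \<in> set G"
      then obtain j where "j < length G" "e = G ! j" by (metis in_set_conv_nth)
      with *(1) have "fst e < snd e" "snd e < ?l" by auto
      then show "e \<in> {..<?l} \<times> {..<?l}" by (cases e) auto
    qed
    moreover have "length G \<le> ?N"
      using *(4) sum_nonneg[of "{..<?l}" "\<lambda>v. int (\<gamma> v)"] by simp
    moreover have "\<gamma> v \<le> ?N" if "v < ?l" for v
      using *(4) member_le_sum[of v "{..<?l}" "\<lambda>v. int (\<gamma> v)"] that by simp
    ultimately show ?case using *(2,3) unfolding t by auto
  qed
  then show ?thesis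
    by (rule finite_subset) (intro finite_cartesian_product finite_lists_length_le
        finite_set_of_finite_funs; simp)
qed

text \<open>
  For a connected graph the common blocks of the flow sum collapse to a single one, which
  gives the least possible degree.
\<close>
lemma connected_one_block:
  assumes conn: "Digraph_Component.connected (code_graph l G)"
    and part: "partition_on {..<l} \<D>"
    and closed: "\<And>j A. j < length G \<Longrightarrow> A \<in> \<D> \<Longrightarrow> \<not> separates (fst (G ! j)) (snd (G ! j)) A"
  shows "card \<D> = 1"
proof -
  let ?H = "with_proj (mk_symmetric (code_graph l G))"
  have ne: "{..<l} \<noteq> {}" and reach: "\<And>u v. u < l \<Longrightarrow> v < l \<Longrightarrow> u \<rightarrow>\<^sup>*\<^bsub>?H\<^esub> v"
    using conn by (auto simp: Digraph_Component.connected_def strongly_connected_def)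
  have full: "A = {..<l}" if A: "A \<in> \<D>" for A
  proof -
    have "A \<noteq> {}" "A \<subseteq> {..<l}" using part A by (auto simp: partition_on_def)
    then obtain u where u: "u \<in> A" "u < l" by auto
    have "v \<in> A" if "v < l" for v
    proof -
      from reach[OF u(2) that] have "(u, v) \<in> rtrancl_on (verts ?H) (arcs_ends ?H)"
        by (simp add: reachable_def)
      then show ?thesis
      proof (induction rule: rtrancl_on_induct)
        case (step y z)
        then have "(y, z) \<in> parcs (mk_symmetric (code_graph l G))" by simp
        then obtain j where "j < length G"
          "y = fst (G ! j) \<and> z = snd (G ! j) \<or> y = snd (G ! j) \<and> z = fst (G ! j)"
          by (auto simp: parcs_mk_symmetric prod_eq_iff)
        with closed[of j A] A step.IH show ?case by (auto simp: separates_def)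
      qed (rule u(1))
    qed
    with \<open>A \<subseteq> {..<l}\<close> show ?thesis by auto
  qed
  moreover have "\<D> \<noteq> {}" using part ne by (auto simp: partition_on_def)
  ultimately have "\<D> = {{..<l}}" by blast
  then show ?thesis by simp
qed

section \<open>Polynomiality in a chamber\<close>

definition cover_weight :: "real \<Rightarrow> int ^ 'n::finite \<Rightarrow> nat list \<Rightarrow> 'n cover \<Rightarrow> real" where
  "cover_weight s x ls \<pi> =
     (\<Prod>v\<in>verts (skel \<pi>). s ^ (1 + valency x \<pi> v) *
        vertex_mult (ls ! v) (vgen \<pi> v) (adjacent_weights x \<pi> v)) *
     (\<Prod>e\<in>arcs (skel \<pi>). real (wt \<pi> e))"

lemma cover_weight_iso:
  assumes "cover_iso f \<pi> \<pi>'"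
  shows "cover_weight s x ls \<pi> = cover_weight s x ls \<pi>'"
proof -
  have V: "verts (skel \<pi>) = verts (skel \<pi>')" and bij: "bij_betw f (arcs (skel \<pi>)) (arcs (skel \<pi>'))"
    and vg: "\<And>v. v \<in> verts (skel \<pi>') \<Longrightarrow> vgen \<pi>' v = vgen \<pi> v"
    and w: "\<And>e. e \<in> arcs (skel \<pi>) \<Longrightarrow> wt \<pi>' (f e) = wt \<pi> e"
    using assms by (auto simp: cover_iso_def)
  have "(\<Prod>e\<in>arcs (skel \<pi>'). real (wt \<pi>' e)) = (\<Prod>e\<in>arcs (skel \<pi>). real (wt \<pi>' (f e)))"
    by (rule prod.reindex_bij_betw[OF bij, symmetric])
  also have "\<dots> = (\<Prod>e\<in>arcs (skel \<pi>). real (wt \<pi> e))" using w by simp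
  finally show ?thesis
    using vg by (simp add: cover_weight_def V valency_def cover_iso_adjacent_weights[OF assms])
qed

text \<open>
  The degree count for one combinatorial type with \<open>m\<close> bounded edges and \<open>l\<close> vertices: the
  vertices contribute twice the sum of the genera, the edge weights \<open>m\<close>, and the
  summation over the flows \<open>m + 1 - l\<close>; the condition on the first Betti number turns this into
  \<open>2 * g + l - 1\<close>.
\<close>
lemma poly_on_type:
  fixes C :: "(real ^ 'n::finite) set" and a :: "'n \<Rightarrow> nat"
  defines "Y \<equiv> {x :: int ^ 'n. (\<chi> i. real_of_int (vec_nth x i)) \<in> C}"
  assumes C: "C \<in> resonance_chambers" and type: "(G, a, \<gamma>) \<in> cover_types g ls"
  shows "poly_on Y (range (\<lambda>i x. real_of_int (vec_nth x i))) (2 * g + length ls - 1)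
    (\<lambda>x. \<Sum>w\<in>type_flows x (length ls) G a.
      cover_weight s x ls (coded_cover p (length ls) G a \<gamma> w))"
proof -
  let ?l = "length ls" and ?m = "length G" and ?L = "range (\<lambda>i (x :: int ^ 'n). real_of_int (vec_nth x i))"
  let ?V = "{..<?l}" and ?E = "{..<?m}"
  let ?src = "\<lambda>j. fst (G ! j)" and ?tgt = "\<lambda>j. snd (G ! j)"
  have edges: "\<And>j. j < ?m \<Longrightarrow> ?src j < ?tgt j \<and> ?tgt j < ?l"
    and conn: "Digraph_Component.connected (code_graph ?l G)" and a: "\<And>i. a i < ?l"
    and betti: "int ?m - int ?l + 1 + (\<Sum>v<?l. int (\<gamma> v)) = int g"
    using type by (auto simp: cover_types_def)
  have sign: "sgn (\<Sum>i\<in>I. vec_nth x i) = sgn (\<Sum>i\<in>I. vec_nth y i)" if "x \<in> Y" "y \<in> Y" for x y I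
  proof -
    have "sgn (real_of_int (\<Sum>i\<in>I. vec_nth x i)) = sgn (real_of_int (\<Sum>i\<in>I. vec_nth y i))"
      using sgn_sum_chamber[OF C, of "\<chi> i. real_of_int (vec_nth x i)" "\<chi> i. real_of_int (vec_nth y i)" I] that
      by (simp add: Y_def)
    moreover have "sgn (real_of_int m) = sgn (real_of_int k) \<Longrightarrow> sgn m = sgn k" for m k
      by (auto simp: sgn_if split: if_splits)
    ultimately show ?thesis by blast
  qed
  have excess_sum: "sum (excess x a) S = (\<Sum>i | a i \<in> S. vec_nth x i)" if "finite S" for S x
  proof -
    have "(\<Sum>v\<in>S. \<Sum>i | i \<in> {i. a i \<in> S} \<and> a i = v. vec_nth x i) = (\<Sum>i | a i \<in> S. vec_nth x i)"
      by (rule sum.group) (use that in auto)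
    moreover have "{i. i \<in> {i. a i \<in> S} \<and> a i = v} = {i. a i = v}" if "v \<in> S" for v
      using that by auto
    ultimately show ?thesis by (simp add: excess_def)
  qed
  have zs: "excess x a \<in> zero_sum ?V" if "x \<in> Y" for x
  proof -
    have "C \<subseteq> resonance_complement"
      using C in_components_subset unfolding resonance_chambers_def by blast
    with that have "(\<Sum>i\<in>UNIV. real_of_int (vec_nth x i)) = 0"
      by (auto simp: Y_def resonance_complement_def)
    then have "(\<Sum>i\<in>UNIV. vec_nth x i) = 0" by (metis of_int_sum of_int_eq_0_iff)
    moreover have "{i. a i \<in> ?V} = UNIV" using a by auto
    ultimately show ?thesis using excess_sum[of ?V x] by (simp add: zero_sum_def)
  qed
  have coord: "poly_on Y ?L (Suc 0) (\<lambda>x. real_of_int (vec_nth x i))" for i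
    by (rule poly_on_coord) simp

  have mono: "\<exists>D. D + ?l = sum k ?E + ?m + 1 \<and>
      poly_on Y ?L D (\<lambda>x. flow_sum ?V ?src ?tgt ?E k (excess x a))" for k
  proof -
    have "\<exists>\<D> D. partition_on ?V \<D> \<and> (\<forall>e\<in>?E. \<forall>A\<in>\<D>. \<not> separates (?src e) (?tgt e) A) \<and>
        D + card ?V = sum k ?E + card ?E + card \<D> \<and>
        cut_polynomial ?V \<D> D (flow_sum ?V ?src ?tgt ?E k)"
      by (rule flow_sum_cut_polynomial) (use edges less_trans in auto)
    then obtain \<D> D where part: "partition_on ?V \<D>"
      and closed: "\<forall>e\<in>?E. \<forall>A\<in>\<D>. \<not> separates (?src e) (?tgt e) A"
      and D: "D + card ?V = sum k ?E + card ?E + card \<D>"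
      and poly: "cut_polynomial ?V \<D> D (flow_sum ?V ?src ?tgt ?E k)"
      by (elim exE conjE)
    have "card \<D> = 1"
      using closed by (intro connected_one_block[OF conn part]) auto
    moreover have "poly_on Y ?L D (\<lambda>x. flow_sum ?V ?src ?tgt ?E k (excess x a))"
    proof (rule cut_polynomial_on_cell[OF poly zs])
      show "poly_on Y ?L (Suc 0) (\<lambda>x. real_of_int (excess x a v))" for v
        unfolding excess_def of_int_sum by (intro poly_on_sum coord)
      show "sgn (sum (excess x a) S) = sgn (sum (excess y a) S)"
        if "x \<in> Y" "y \<in> Y" "S \<subseteq> ?V" for x y S
        using sign[OF that(1,2)] finite_subset[OF that(3)] by (simp add: excess_sum)
    qed
    ultimately show ?thesis using D by auto
  qed
  from mono[of "\<lambda>_. 0"] have le: "?l \<le> ?m + 1" by auto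
  have mono': "poly_on Y ?L (sum k ?E + (?m + 1 - ?l)) (\<lambda>x. flow_sum ?V ?src ?tgt ?E k (excess x a))" for k
  proof -
    from mono[of k] obtain D where D: "D + ?l = sum k ?E + ?m + 1"
      and poly: "poly_on Y ?L D (\<lambda>x. flow_sum ?V ?src ?tgt ?E k (excess x a))" by blast
    have "D = sum k ?E + (?m + 1 - ?l)" using D le by linarith
    with poly show ?thesis by (simp only:)
  qed

  let ?Lw = "(\<lambda>l z. l (fst z)) ` ?L \<union> (\<lambda>e z. real (snd z e)) ` ?E"
  let ?arcs = "\<lambda>v. in_arcs (code_graph ?l G) v \<union> out_arcs (code_graph ?l G) v"
  let ?f = "\<lambda>z :: (int ^ 'n) \<times> (nat \<Rightarrow> nat). \<Prod>v<?l. s ^ (1 + type_valency ?l G a v) * vertex_mult (ls ! v) (\<gamma> v)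
      (image_mset (snd z) (mset_set (?arcs v)) + image_mset (\<lambda>i. nat \<bar>vec_nth (fst z) i\<bar>) (mset_set {i. a i = v}))"
  have "poly_on (Y \<times> UNIV) ?Lw (\<Sum>v<?l. 2 * \<gamma> v) ?f"
  proof (rule poly_on_prod, rule poly_on_cmult, rule poly_on_vertex_mult)
    fix v e assume "e \<in> ?arcs v"
    then show "poly_on (Y \<times> UNIV) ?Lw (Suc 0) (\<lambda>z. real (snd z e))"
      by (intro poly_on_coord) auto
  next
    fix i
    have c: "poly_on (Y \<times> UNIV) ?Lw (Suc 0) (\<lambda>z. real_of_int (vec_nth (fst z) i))"
      by (rule poly_on_coord) auto
    \<comment> \<open>The sign of an entry is constant on the chamber; it is read off at some point of it.\<close>
    show "poly_on (Y \<times> UNIV) ?Lw (Suc 0) (\<lambda>z. real (nat \<bar>vec_nth (fst z) i\<bar>))"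
    proof (rule poly_on.cong[OF poly_on_cmult[OF c, of "real_of_int (sgn (vec_nth (SOME x. x \<in> Y) i))"]])
      fix z assume "z \<in> Y \<times> (UNIV :: (nat \<Rightarrow> nat) set)"
      then have z: "fst z \<in> Y" by auto
      then have "(SOME x. x \<in> Y) \<in> Y" by (rule someI)
      from sign[OF this z, of "{i}"] have "sgn (vec_nth (SOME x. x \<in> Y) i) = sgn (vec_nth (fst z) i)" by simp
      moreover have "real_of_int (sgn t) * real_of_int t = real (nat \<bar>t\<bar>)" for t
        by (simp add: sgn_if)
      ultimately show "real_of_int (sgn (vec_nth (SOME x. x \<in> Y) i)) * real_of_int (vec_nth (fst z) i) =
          real (nat \<bar>vec_nth (fst z) i\<bar>)" by (simp only:)
    qed
  qed
  from poly_on_flow_sum[OF _ mono' this, of "\<lambda>_. 1"]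
  have "poly_on Y ?L ((\<Sum>v<?l. 2 * \<gamma> v) + ?m + (?m + 1 - ?l))
      (\<lambda>x. \<Sum>w\<in>type_flows x ?l G a. ?f (x, w) * (\<Prod>e\<in>?E. real (w e)))" by simp
  moreover have "(\<Sum>v<?l. 2 * \<gamma> v) + ?m + (?m + 1 - ?l) = 2 * g + ?l - 1"
  proof -
    have "(\<Sum>v<?l. int (\<gamma> v)) = int (\<Sum>v<?l. \<gamma> v)" by simp
    with betti le show ?thesis unfolding sum_distrib_left[symmetric] by linarith
  qed
  moreover have "cover_weight s x ls (coded_cover p ?l G a \<gamma> w) = ?f (x, w) * (\<Prod>e\<in>?E. real (w e))" for x w
    by (simp add: cover_weight_def valency_coded_cover adjacent_weights_def)
  ultimately show ?thesis by simp
qed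

text \<open>The two invariants are the cases \<open>s = 1\<close> and \<open>s = -1\<close>.\<close>
definition invariant :: "real \<Rightarrow> (nat \<Rightarrow> real) \<Rightarrow> nat \<Rightarrow> int ^ 'n::finite \<Rightarrow> nat multiset \<Rightarrow> real" where
  "invariant s p g x lam = (\<Sum>ls\<in>permutations_of_multiset lam.
     \<Sum>K\<in>covers p g x ls // cover_rel p g x ls. 1 / real (card (Aut (SOME \<pi>. \<pi> \<in> K))) *
       (1 / fact (length ls) * cover_weight s x ls (SOME \<pi>. \<pi> \<in> K)))"

lemma h_le_eq_invariant: "h_le p g x lam = invariant 1 p g x lam"
  by (simp add: h_le_def h_vec_le_def cover_mult_le_def invariant_def cover_weight_def mult.assoc)

lemma h_lt_eq_invariant: "h_lt p g x lam = invariant (-1) p g x lam"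
  by (simp add: h_lt_def h_vec_lt_def cover_mult_lt_def invariant_def cover_weight_def mult.assoc)

lemma invariant_polynomial_on_chamber:
  fixes C :: "(real ^ 'n::finite) set"
  assumes pos: "\<forall>k\<in>#lam. k > 0"
    and sum: "int (sum_mset lam) = 2 * int g - 2 + int CARD('n)"
    and p: "strict_mono_on {..<size lam} p"
    and C: "C \<in> resonance_chambers"
  shows "polynomial_on_chamber C (\<lambda>x. invariant s p g x lam) (4 * int g - 3 + int CARD('n))"
proof (cases "lam = {#}")
  case True
  \<comment> \<open>The only case of a negative degree bound. A connected graph has a vertex, so there is no cover.\<close>
  have "covers p g x [] = {}" for x :: "int ^ 'n"
    by (auto simp: covers_def)
  then have "invariant s p g x lam = 0" for x :: "int ^ 'n"
    by (simp add: invariant_def True)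
  then show ?thesis
    unfolding polynomial_on_chamber_def
    by (intro exI[of _ 0]) (simp add: poly_eval_0 total_degree_le_def)
next
  case False
  let ?Y = "{x :: int ^ 'n. (\<chi> i. real_of_int (vec_nth x i)) \<in> C}"
  let ?L = "range (\<lambda>i (x :: int ^ 'n). real_of_int (vec_nth x i))"
  define d where "d = 2 * g + size lam - 1"
  have "size lam \<le> sum_mset lam" using pos
    by (induction lam) (auto simp: Suc_le_eq intro: add_mono)
  moreover have "size lam > 0" using False by (simp add: nonempty_has_size)
  ultimately have d: "int d \<le> 4 * int g - 3 + int CARD('n)"
    using sum unfolding d_def by linarith
  have "poly_on ?Y ?L d (\<lambda>x. \<Sum>ls\<in>permutations_of_multiset lam.
      \<Sum>K\<in>covers p g x ls // cover_rel p g x ls. 1 / real (card (Aut (SOME \<pi>. \<pi> \<in> K))) *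
       (1 / fact (length ls) * cover_weight s x ls (SOME \<pi>. \<pi> \<in> K)))"
  proof (rule poly_on_sum)
    fix ls assume "ls \<in> permutations_of_multiset lam"
    then have lam: "mset ls = lam" by (simp add: permutations_of_multiset_def)
    then have l: "length ls = size lam" by (metis size_mset)
    let ?l = "length ls"
    have p': "strict_mono_on {..<?l} p" using p by (simp add: l)
    have finite_type_flows: "finite (type_flows x ?l G a)" if "(G, a, \<gamma>) \<in> cover_types g ls" for x :: "int ^ 'n" and G a \<gamma>
      using that by (intro finite_flows) (auto simp: cover_types_def)
    have fin: "finite (codes p g x ls)" for x :: "int ^ 'n"
      unfolding codes_eq[OF p'] by (rule finite_SigmaI[OF finite_cover_types]) (auto intro: finite_type_flows)
    have "(\<Sum>K\<in>covers p g x ls // cover_rel p g x ls. 1 / real (card (Aut (SOME \<pi>. \<pi> \<in> K))) *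
       (1 / fact ?l * cover_weight s x ls (SOME \<pi>. \<pi> \<in> K))) =
      (\<Sum>(G, a, \<gamma>)\<in>cover_types g ls. 1 / (fact ?l * fact (length G)) *
        (\<Sum>w\<in>type_flows x ?l G a. cover_weight s x ls (coded_cover p ?l G a \<gamma> w)))" for x :: "int ^ 'n"
    proof -
      have "(\<Sum>K\<in>covers p g x ls // cover_rel p g x ls. 1 / real (card (Aut (SOME \<pi>. \<pi> \<in> K))) *
         (1 / fact ?l * cover_weight s x ls (SOME \<pi>. \<pi> \<in> K))) =
        (\<Sum>c\<in>codes p g x ls. 1 / fact ?l * cover_weight s x ls (decode p ?l c) / fact (length (fst (fst c))))"
        by (rule sum_classes_eq_sum_codes[OF fin]) (metis cover_weight_iso)
      also have "\<dots> = (\<Sum>t\<in>cover_types g ls. \<Sum>w\<in>(case t of (G, a, \<gamma>) \<Rightarrow> type_flows x ?l G a).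
          1 / fact ?l * cover_weight s x ls (decode p ?l (t, w)) / fact (length (fst t)))"
        unfolding codes_eq[OF p']
        by (subst sum.Sigma[OF finite_cover_types])
          (auto intro: finite_type_flows simp: case_prod_unfold)
      also have "\<dots> = (\<Sum>(G, a, \<gamma>)\<in>cover_types g ls. 1 / (fact ?l * fact (length G)) *
        (\<Sum>w\<in>type_flows x ?l G a. cover_weight s x ls (coded_cover p ?l G a \<gamma> w)))"
        by (rule sum.cong) (auto simp: decode_def sum_distrib_left)
      finally show ?thesis .
    qed
    moreover have "poly_on ?Y ?L d (\<lambda>x. \<Sum>(G, a, \<gamma>)\<in>cover_types g ls. 1 / (fact ?l * fact (length G)) *
        (\<Sum>w\<in>type_flows x ?l G a. cover_weight s x ls (coded_cover p ?l G a \<gamma> w)))"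
      unfolding case_prod_unfold d_def l[symmetric]
      by (intro poly_on_sum poly_on_cmult poly_on_type[OF C]) simp
    ultimately show "poly_on ?Y ?L d (\<lambda>x. \<Sum>K\<in>covers p g x ls // cover_rel p g x ls.
        1 / real (card (Aut (SOME \<pi>. \<pi> \<in> K))) * (1 / fact ?l * cover_weight s x ls (SOME \<pi>. \<pi> \<in> K)))"
      by simp
  qed
  then have "poly_on ?Y (range (\<lambda>i x. vec_nth (\<chi> i. real_of_int (vec_nth x i)) i)) d (\<lambda>x. invariant s p g x lam)"
    by (simp add: invariant_def)
  from poly_on_imp_poly_eval[OF this] obtain P where P: "total_degree_le P (int d)"
    "\<forall>x\<in>?Y. invariant s p g x lam = poly_eval P (\<chi> i. real_of_int (vec_nth x i))" by blast
  have "total_degree_le P (4 * int g - 3 + int CARD('n))"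
    using P(1) d unfolding total_degree_le_def by (meson order_trans)
  with P(2) show ?thesis
    unfolding polynomial_on_chamber_def by (intro exI[of _ P]) simp
qed

theorem theorem3p3:
  fixes g :: nat
    and lam :: "nat multiset"
    and p :: "nat \<Rightarrow> real"
    and C :: "(real ^ 'n::finite) set"
  assumes "\<forall>k\<in>#lam. k > 0"
    and "int (sum_mset lam) = 2 * int g - 2 + int CARD('n)"
    and "strict_mono_on {..<size lam} p"
    and "C \<in> resonance_chambers"
  shows "polynomial_on_chamber C (\<lambda>x. h_le p g x lam) (4 * int g - 3 + int CARD('n)) \<and>
         polynomial_on_chamber C (\<lambda>x. h_lt p g x lam) (4 * int g - 3 + int CARD('n))"
  unfolding h_le_eq_invariant h_lt_eq_invariant
  using invariant_polynomial_on_chamber[OF assms] by blast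

end
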